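(* Consider the generalized equation $0\in\Phi x=Fx+Tx$ under the standing assumptions (A1)--(A4) of the context, and assume $L\rho<1$. Let $\hat L>L$ be such that $\hat L\rho<1$, and let $\bar\beta:=\frac{\lambda(4-\hat L\lambda)-4\rho}{4(1-\rho\hat L)}$ and $\Lambda:=\frac{\hat L-L}{L\hat L}$. Let $\{(x^k,y^k,z^k)\}$ be generated by the VFOSA$_+$ iteration (see context) using an estimator $\widetilde F^k$ of $Fx^k$ satisfying the $\mathbf{VR}(\Delta_k;\kappa_k,\Theta_k,\sigma_k)$ property (see context). Assume that $$2\rho\le\lambda<\tfrac{2(1+\sqrt{1-\hat L\rho})}{\hat L},\quad 0<\mu<\tfrac23,\quad r\ge 2+\tfrac1\mu,\quad \nu:=\tfrac\mu2,\quad 0<\beta<\tfrac{(2-\mu)\bar\beta}{2+\mu},\quad t_k:=\mu(k+r),\quad \eta_k:=\tfrac{2\beta(t_k-1)}{t_k-\nu},$$ and that there are parameters $\Gamma_k$ and constants $\underline\Theta>0$, $\underline\Gamma>0$ such that for all $k\ge0$: $$\kappa_k\ge 1-\frac{\Gamma_{k-1}t_{k-2}(t_{k-2}-1)}{\Gamma_kt_{k-1}(t_{k-1}-1)}+\frac{5\beta}{\mu\Gamma_k},\qquad \Gamma_k\ge\underline\Gamma,\qquad \Theta_k\ge\underline\Theta,\qquad \Gamma_k\Theta_k\le\Lambda.$$ Assume also that $B_\infty:=\frac{\Lambda}{\beta}\sum_{k=0}^\infty t_{k-1}(t_{k-1}-1)\frac{\sigma_k^2}{\Theta_k}<+\infty$.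 Then, almost surely, $$\sum_{k=0}^\infty(k+1)\|G_\lambda x^k\|^2<+\infty,\quad \sum_{k=0}^\infty(k+1)^2\|\widetilde F^k-Fx^k\|^2<+\infty,\quad \sum_{k=0}^\infty(k+1)\|x^{k+1}-x^k\|^2<+\infty,$$ and, almost surely, $$\lim_{k\to\infty}k^2\|G_\lambda x^k\|^2=0,\qquad \lim_{k\to\infty}k^2\|x^{k+1}-x^k\|^2=0.$$ Moreover, both $\{x^k\}$ and $\{z^k\}$ almost surely converge to a $\mathrm{zer}(\Phi)$-valued random variable $x^\star$, i.e. to a solution of $0\in\Phi x$.
   Context: Problem: $F:\mathbb{R}^p\to\mathbb{R}^p$ is single-valued, $T:\mathbb{R}^p\rightrightarrows2^{\mathbb{R}^p}$ is possibly multi-valued, $\Phi:=F+T$, $\mathrm{dom}(\Phi)=\{x:\Phi x\ne\emptyset\}$, $\mathrm{zer}(\Phi):=\{x:0\in\Phi x\}$. There are two settings: the finite-sum setting $Fx=\frac1n\sum_{i=1}^nF_ix$, and the expectation setting $Fx=\mathbb{E}_\xi[\mathbf F(x,\xi)]$ for a random variable $\xi$. (In the finite-sum setting, $\mathbf F(x,\xi)$ means $F_ix$ with $i$ uniform on $\{1,\dots,n\}$.) Standing assumptions. (A1) $\mathrm{zer}(\Phi)\neq\emptyset$. (A2) In the expectation setting there is $\sigma\ge0$ with $\mathbb{E}_\xi[\|\mathbf F(x,\xi)-Fx\|^2]\le\sigma^2$ for all $x\in\mathrm{dom}(F)$. (A3) $T$ is maximally $\rho$-co-hypomonotone for some $\rho\ge0$: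 $\langle u-v,x-y\rangle\ge-\rho\|u-v\|^2$ for all $(x,u),(y,v)$ in the graph of $T$, and the graph is not properly contained in that of another such operator. (A4) There is $L>0$ such that for all $x,y\in\mathrm{dom}(F)$: in the finite-sum setting, $\langle Fx-Fy,x-y\rangle\ge\frac1{nL}\sum_{i=1}^n\|F_ix-F_iy\|^2$; in the expectation setting, $\langle Fx-Fy,x-y\rangle\ge\frac1L\mathbb{E}_\xi[\|\mathbf F(x,\xi)-\mathbf F(y,\xi)\|^2]$. Operators: for $\lambda>0$, $J_{\lambda T}x:=\{w:x\in w+\lambda Tw\}$ is the resolvent of $\lambda T$, and $G_\lambda x:=\frac1\lambda\big(x-J_{\lambda T}(x-\lambda Fx)\big)$ is the forward-backward splitting residual. VFOSA$_+$ iteration: given $x^0\in\mathrm{dom}(\Phi)$, $z^0:=x^0$, for $k\ge0$: $y^k:=\frac{t_k-1}{t_k}x^k+\frac1{t_k}z^k$; $x^{k+1}:=y^k-\eta_k\widetilde G_\lambda^k$; $z^{k+1}:=z^k+\nu(x^{k+1}-y^k)$, where $\widetilde G_\lambda^k:=\frac1\lambda\big(x^k-J_{\lambda T}(x^k-\lambda\widetilde F^k)\big)$ and $\widetilde F^k$ is a stochastic estimator of $Fx^k$. The formula $t_k=\mu(k+r)$ is used for all integers $k\ge-2$, and $\Gamma_{-1}>0$ as well. $\mathcal F_k$ is the $\sigma$-algebra generated by all the randomness of the algorithm up to the current iterates $x^0,\dots,x^k$ (the samples drawn at iteration $k$ to build $\widetilde F^k$ are not included), and $\mathbb{E}_k[\cdot]=\mathbb{E}[\cdot\mid\mathcal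 F_k]$. $\mathbf{VR}(\Delta_k;\kappa_k,\Theta_k,\sigma_k)$ property: there are parameters $\kappa_k\in(0,1]$, $\Theta_k\ge0$, $\sigma_k\ge0$ and random quantities $\Delta_k\ge0$ such that almost surely for all $k\ge0$: $\mathbb{E}_k[\|\widetilde F^k-Fx^k\|^2]\le\mathbb{E}_k[\Delta_k]$ and $\mathbb{E}_k[\Delta_k]\le(1-\kappa_k)\Delta_{k-1}+\Theta_k\bar{\mathcal E}_k+\sigma_k^2$, where $\bar{\mathcal E}_k:=\mathbb{E}_\xi[\|\mathbf F(x^k,\xi)-\mathbf F(x^{k-1},\xi)\|^2]$ (i.e. $\frac1n\sum_i\|F_ix^k-F_ix^{k-1}\|^2$ in the finite-sum setting), $x^{-1}:=x^0$, $\Delta_{-1}:=0$. *)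

theory Defs
  imports "HOL-Probability.Probability"
begin

definition graph :: "('a \<Rightarrow> 'b set) \<Rightarrow> ('a \<times> 'b) set" where
  "graph T = {(x, u). u \<in> T x}"

definition op_dom :: "('a \<Rightarrow> 'b set) \<Rightarrow> 'a set" where
  "op_dom \<Phi> = {x. \<Phi> x \<noteq> {}}"

definition zer :: "('a \<Rightarrow> 'b::zero set) \<Rightarrow> 'a set" where
  "zer \<Phi> = {x. 0 \<in> \<Phi> x}"

definition op_plus :: "('a \<Rightarrow> 'b::plus) \<Rightarrow> ('a \<Rightarrow> 'b set) \<Rightarrow> 'a \<Rightarrow> 'b set" where
  "op_plus F T x = {F x + u |u. u \<in> T x}"

definition co_hypomonotone :: "real \<Rightarrow> ('a::real_inner \<Rightarrow> 'a set) \<Rightarrow> bool" where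
  "co_hypomonotone \<rho> T \<longleftrightarrow>
     (\<forall>(x, u) \<in> graph T. \<forall>(y, v) \<in> graph T. (u - v) \<bullet> (x - y) \<ge> - \<rho> * (norm (u - v))\<^sup>2)"

definition maximally_co_hypomonotone :: "real \<Rightarrow> ('a::real_inner \<Rightarrow> 'a set) \<Rightarrow> bool" where
  "maximally_co_hypomonotone \<rho> T \<longleftrightarrow>
     co_hypomonotone \<rho> T \<and> \<not> (\<exists>S. co_hypomonotone \<rho> S \<and> graph T \<subset> graph S)"

definition resolvent :: "real \<Rightarrow> ('a::real_vector \<Rightarrow> 'a set) \<Rightarrow> 'a \<Rightarrow> 'a set" where
  "resolvent l T x = {w. x \<in> {w + l *\<^sub>R u |u. u \<in> T w}}"

text \<open>
  For a maximally \<open>\<rho>\<close>-co-hypomonotone \<open>T\<close> on a Euclidean space and \<open>l > \<rho> \<ge> 0\<close> the resolvent is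
  a singleton at every point (Minty's theorem for the maximally monotone operator with graph
  \<open>{(u, x + \<rho> u). u \<in> T x}\<close>), so \<open>the_elem\<close> below merely turns it into a point. The argument \<open>v\<close>
  is \<open>F x\<close> for the exact residual and the estimator of \<open>F x\<close> for its stochastic counterpart.
\<close>

definition fbs_residual :: "real \<Rightarrow> ('a::real_vector \<Rightarrow> 'a set) \<Rightarrow> 'a \<Rightarrow> 'a \<Rightarrow> 'a" where
  "fbs_residual l T v x = (1 / l) *\<^sub>R (x - the_elem (resolvent l T (x - l *\<^sub>R v)))"

abbreviation FBS :: "real \<Rightarrow> ('a::real_vector \<Rightarrow> 'a) \<Rightarrow> ('a \<Rightarrow> 'a set) \<Rightarrow> 'a \<Rightarrow> 'a" where
  "FBS l F T x \<equiv> fbs_residual l T (F x) x"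

text \<open>
  \<open>Finite_Sum n Fs\<close> has the components \<open>Fs 1, \<dots>, Fs n\<close>; \<open>Expectation D bF\<close> has the samples
  \<open>\<xi>\<close> with law \<open>D\<close> and the integrand \<open>bF x \<xi>\<close>.
\<close>

datatype ('s, 'a) model =
    Finite_Sum nat "nat \<Rightarrow> 'a \<Rightarrow> 'a"
  | Expectation "'s measure" "'a \<Rightarrow> 's \<Rightarrow> 'a"

primrec valid_model :: "('s, 'a::euclidean_space) model \<Rightarrow> bool" where
  "valid_model (Finite_Sum n Fs) \<longleftrightarrow> n \<ge> 1"
| "valid_model (Expectation D bF) \<longleftrightarrow> prob_space D \<and> (\<forall>x. integrable D (bF x))"

primrec mean_op :: "('s, 'a::euclidean_space) model \<Rightarrow> 'a \<Rightarrow> 'a" where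
  "mean_op (Finite_Sum n Fs) x = (1 / real n) *\<^sub>R (\<Sum>i = 1..n. Fs i x)"
| "mean_op (Expectation D bF) x = (LINT \<xi>|D. bF x \<xi>)"

text \<open>
  The variance bound is a condition on the expectation setting only. It makes every \<open>bF x\<close>
  square integrable, so the Bochner integral in \<open>mean_sq_diff\<close> is a genuine one.
\<close>

primrec bounded_variance :: "('s, 'a::euclidean_space) model \<Rightarrow> bool" where
  "bounded_variance (Finite_Sum n Fs) \<longleftrightarrow> True"
| "bounded_variance (Expectation D bF) \<longleftrightarrow>
     (\<exists>\<sigma>\<ge>0. \<forall>x. (\<integral>\<^sup>+\<xi>. ennreal ((norm (bF x \<xi> - mean_op (Expectation D bF) x))\<^sup>2) \<partial>D)
        \<le> ennreal (\<sigma>\<^sup>2))"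

primrec mean_sq_diff :: "('s, 'a::euclidean_space) model \<Rightarrow> 'a \<Rightarrow> 'a \<Rightarrow> real" where
  "mean_sq_diff (Finite_Sum n Fs) x y = (1 / real n) * (\<Sum>i = 1..n. (norm (Fs i x - Fs i y))\<^sup>2)"
| "mean_sq_diff (Expectation D bF) x y = (LINT \<xi>|D. (norm (bF x \<xi> - bF y \<xi>))\<^sup>2)"

definition average_co_coercive :: "real \<Rightarrow> ('s, 'a::euclidean_space) model \<Rightarrow> bool" where
  "average_co_coercive L S \<longleftrightarrow>
     (\<forall>x y. (mean_op S x - mean_op S y) \<bullet> (x - y) \<ge> (1 / L) * mean_sq_diff S x y)"

text \<open>
  One sample path of the iteration; \<open>Ft k\<close> is the value of the estimator of \<open>F (x k)\<close>. The
  sequence \<open>t\<close> is indexed by \<open>int\<close> because \<open>t (-2)\<close> and \<open>t (-1)\<close> enter the parameter conditions.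
\<close>

definition vfosa_plus ::
  "real \<Rightarrow> ('a::real_vector \<Rightarrow> 'a set) \<Rightarrow> (int \<Rightarrow> real) \<Rightarrow> (nat \<Rightarrow> real) \<Rightarrow> real \<Rightarrow> 'a \<Rightarrow>
     (nat \<Rightarrow> 'a) \<Rightarrow> (nat \<Rightarrow> 'a) \<Rightarrow> (nat \<Rightarrow> 'a) \<Rightarrow> (nat \<Rightarrow> 'a) \<Rightarrow> bool" where
  "vfosa_plus l T t \<eta> \<nu> x0 Ft x y z \<longleftrightarrow>
     x 0 = x0 \<and> z 0 = x0 \<and>
     (\<forall>k. y k = ((t (int k) - 1) / t (int k)) *\<^sub>R x k + (1 / t (int k)) *\<^sub>R z k \<and>
          x (Suc k) = y k - \<eta> k *\<^sub>R fbs_residual l T (Ft k) (x k) \<and>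
          z (Suc k) = z k + \<nu> *\<^sub>R (x (Suc k) - y k))"

text \<open>
  The conditional expectations are those of nonnegative quantities, hence \<open>nn_cond_exp\<close>, which
  presupposes no integrability. At \<open>k = 0\<close> the convention \<open>x\<^sup>-\<^sup>1 = x\<^sup>0\<close> is realised by truncated
  subtraction on \<open>nat\<close>, whereas the convention for \<open>\<Delta>\<close> needs the case distinction.
\<close>

definition VR_property ::
  "'w measure \<Rightarrow> (nat \<Rightarrow> 'w measure) \<Rightarrow> ('s, 'a::euclidean_space) model \<Rightarrow>
     (nat \<Rightarrow> 'w \<Rightarrow> 'a) \<Rightarrow> (nat \<Rightarrow> 'w \<Rightarrow> 'a) \<Rightarrow> (nat \<Rightarrow> 'w \<Rightarrow> real) \<Rightarrow>
     (nat \<Rightarrow> real) \<Rightarrow> (nat \<Rightarrow> real) \<Rightarrow> (nat \<Rightarrow> real) \<Rightarrow> bool" where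
  "VR_property M \<F> S x Ft \<Delta> \<kappa> \<Theta> \<sigma> \<longleftrightarrow>
     (\<forall>k. 0 < \<kappa> k \<and> \<kappa> k \<le> 1 \<and> 0 \<le> \<Theta> k \<and> 0 \<le> \<sigma> k) \<and>
     (\<forall>k. \<Delta> k \<in> borel_measurable M \<and> (\<forall>\<omega>\<in>space M. 0 \<le> \<Delta> k \<omega>)) \<and>
     (AE \<omega> in M. \<forall>k.
        nn_cond_exp M (\<F> k) (\<lambda>\<omega>'. ennreal ((norm (Ft k \<omega>' - mean_op S (x k \<omega>')))\<^sup>2)) \<omega>
          \<le> nn_cond_exp M (\<F> k) (\<lambda>\<omega>'. ennreal (\<Delta> k \<omega>')) \<omega> \<and>
        nn_cond_exp M (\<F> k) (\<lambda>\<omega>'. ennreal (\<Delta> k \<omega>')) \<omega>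
          \<le> ennreal ((1 - \<kappa> k) * (if k = 0 then 0 else \<Delta> (k - 1) \<omega>)
                      + \<Theta> k * mean_sq_diff S (x k \<omega>) (x (k - 1) \<omega>) + (\<sigma> k)\<^sup>2))"

text \<open>
  The \<open>\<sigma>\<close>-algebras \<open>\<F> k\<close> may be those generated by all randomness of the algorithm up to the
  \<open>k\<close>-th iterate, but any filtration to which the iterates are adapted is admitted.
\<close>

definition iterate_filtration ::
  "'w measure \<Rightarrow> (nat \<Rightarrow> 'w measure) \<Rightarrow> (nat \<Rightarrow> 'w \<Rightarrow> 'a::euclidean_space) \<Rightarrow> bool" where
  "iterate_filtration M \<F> x \<longleftrightarrow>
     filtration (space M) \<F> \<and> (\<forall>k. subalgebra M (\<F> k)) \<and> (\<forall>k. x k \<in> borel_measurable (\<F> k))"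

end

theory Submission
  imports Defs
begin

text \<open>
  The residual \<open>G = FBS l F T\<close> turns the inclusion into the equation \<open>G x = 0\<close>, and it is
  co-coercive: \<open>\<langle>G x - G y, x - y\<rangle> \<ge> \<beta>bar \<parallel>G x - G y\<parallel>\<^sup>2 + Q x y\<close>, where
  \<open>Q x y = \<langle>F x - F y, x - y\<rangle> - (1 / Lhat) \<parallel>F x - F y\<parallel>\<^sup>2\<close> is what is left of the monotonicity of
  \<open>F\<close> when the constant \<open>L\<close> is relaxed to \<open>Lhat\<close> (\<open>FBS_co_coercive\<close>). This surplus dominates
  \<open>\<Lambda>\<close> times the mean squared difference of the samples (\<open>mean_sq_diff_le_excess\<close>), which is the
  quantity that feeds the variance recursion. Because the resolvent is nonexpansive for
  \<open>l \<ge> 2 \<rho>\<close>, replacing \<open>F x\<close> by its estimator perturbs \<open>G x\<close> by some \<open>\<epsilon>\<close> that is no longer than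
  the error of the estimator. That the resolvent is a function at all is Minty's theorem, which
  is derived from Brouwer's fixed point theorem (\<open>resolvent_nonempty\<close>).

  So the algorithm is an accelerated Krasnoselskii-Mann iteration for a co-coercive \<open>G\<close> with
  perturbations \<open>\<epsilon> k\<close>. With \<open>s k = t k (t k - 1)\<close>, which grows like \<open>k\<^sup>2\<close>, and a zero \<open>p\<close> of \<open>G\<close>,
  an energy \<open>V k\<close> of the form
  \<open>t \<langle>G x, x - z\<rangle> + \<beta> t\<^sup>2 \<parallel>G x\<parallel>\<^sup>2 + c \<parallel>z - p\<parallel>\<^sup>2\<close> satisfies, along every sample path,
  \<open>V (k + 1) + s k Q + const t k \<parallel>G\<parallel>\<^sup>2 \<le> (1 + K / s k) V k + (4 \<beta> / \<mu>) s k \<parallel>\<epsilon> k\<parallel>\<^sup>2\<close>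
  (\<open>energy_step\<close>). All products with \<open>\<epsilon> k\<close> are absorbed by Young's inequality, so biased
  estimators are covered as well.

  Randomness is needed only to see that \<open>\<Sum> s k \<parallel>\<epsilon> k\<parallel>\<^sup>2\<close> is almost surely finite
  (\<open>AE_summable_noise\<close>). Take total expectations in the energy inequality and in the variance
  recursion, and multiply the latter by \<open>\<Gamma> (k + 1) s k\<close>. Then its driving term is at most
  \<open>s k E[Q]\<close>, exactly the amount by which the energy decreases, while the condition on \<open>\<kappa>\<close> makes
  \<open>\<Gamma> k t (k-1) (t (k-1) - 1) E[\<Delta> k]\<close> lose \<open>(5 \<beta> / \<mu>) s k E[\<Delta> k]\<close>. Since \<open>4 < 5\<close>, the sum of both
  inequalities leaves \<open>\<Sum> s k E[\<Delta> k] < \<infinity>\<close>.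

  Everything else is deterministic. On a path with summable noise the energy converges and
  \<open>\<Sum> t k \<parallel>G (x k)\<parallel>\<^sup>2 < \<infinity>\<close>. The gap \<open>v k = z k - x k\<close> obeys a recursion contracting with rate
  \<open>1 - 1 / t k\<close>, whence \<open>v k \<longlonglongrightarrow> 0\<close>. The distances \<open>\<parallel>z k - p\<parallel>\<close> converge for every zero \<open>p\<close>, so the
  energy leaves a limit for \<open>k\<^sup>2 \<parallel>G (x k)\<parallel>\<^sup>2\<close>, and the summability forces this limit to be \<open>0\<close>.
  Opial's argument gives the convergence of \<open>x k\<close> and \<open>z k\<close> to a common zero.
\<close>


section \<open>Resolvents of maximally co-hypomonotone operators\<close>

text \<open>
  This is the finite case of the Debrunner-Flor extension theorem. If every \<open>u\<close> violated one of
  the inequalities, then averaging the points \<open>fst p\<close> with the violations as weights would define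
  a continuous self-map of their convex hull. At a Brouwer fixed point \<open>u\<close> the weighted sum of the
  violations is positive, but \<open>u\<close> being the average of the points cancels the contribution of \<open>h\<close>,
  and monotonicity makes the rest nonpositive.
\<close>

lemma monotone_finite_variational_inequality:
  fixes A :: "('a::euclidean_space \<times> 'a) set" and h :: "'a \<Rightarrow> 'a"
  assumes "finite A" "A \<noteq> {}"
    and mono: "\<And>p q. p \<in> A \<Longrightarrow> q \<in> A \<Longrightarrow> 0 \<le> (snd p - snd q) \<bullet> (fst p - fst q)"
    and cont: "continuous_on UNIV h"
  shows "\<exists>u. \<forall>p\<in>A. (h u + snd p) \<bullet> (u - fst p) \<le> 0"
proof (rule ccontr)
  assume contra: "\<not> ?thesis"
  define \<phi> where "\<phi> p u = (h u + snd p) \<bullet> (u - fst p)" for p u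
  define W where "W u = (\<Sum>p\<in>A. max 0 (\<phi> p u))" for u
  define f where "f u = (\<Sum>p\<in>A. (max 0 (\<phi> p u) / W u) *\<^sub>R fst p)" for u
  let ?H = "convex hull (fst ` A)"
  have Wpos: "0 < W u" for u
  proof -
    from contra obtain p where "p \<in> A" "\<phi> p u > 0"
      unfolding \<phi>_def by (meson not_le)
    then show ?thesis
      unfolding W_def using \<open>finite A\<close> by (intro sum_pos2[of A p]) auto
  qed
  have weights: "(\<Sum>p\<in>A. max 0 (\<phi> p u) / W u) = 1" for u
    using Wpos[of u] by (simp add: W_def flip: sum_divide_distrib)
  have hcont: "continuous_on ?H h"
    using cont continuous_on_subset by blast
  have "continuous_on ?H f"
    unfolding f_def \<phi>_def W_def using Wpos
    by (intro continuous_intros hcont) (auto simp: W_def \<phi>_def less_imp_neq[THEN not_sym])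
  moreover have "f u \<in> ?H" for u
    unfolding f_def using \<open>finite A\<close> weights[of u] Wpos[of u]
    by (intro convex_sum) (auto intro!: hull_inc divide_nonneg_pos)
  moreover have "compact ?H" "convex ?H" "?H \<noteq> {}"
    using assms(1,2) by (auto intro: finite_imp_compact_convex_hull)
  ultimately obtain u where u: "f u = u"
    using brouwer[of ?H f] by auto
  define c where "c p = max 0 (\<phi> p u) / W u" for p
  have c1: "(\<Sum>p\<in>A. c p) = 1" and c2: "(\<Sum>p\<in>A. c p *\<^sub>R fst p) = u"
    using weights[of u] u by (simp_all add: c_def f_def)
  have c0: "0 \<le> c p" for p
    using Wpos[of u] by (simp add: c_def)
  from contra obtain p0 where p0: "p0 \<in> A" "\<phi> p0 u > 0"
    unfolding \<phi>_def by (meson not_le)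
  have "0 < (\<Sum>p\<in>A. c p * \<phi> p u)"
    using \<open>finite A\<close> p0 Wpos[of u]
    by (intro sum_pos2[of A p0]) (auto simp: c_def max_def mult_nonneg_nonneg)
  also have "(\<Sum>p\<in>A. c p * \<phi> p u) = h u \<bullet> ((\<Sum>p\<in>A. c p) *\<^sub>R u - (\<Sum>p\<in>A. c p *\<^sub>R fst p))
      + (\<Sum>p\<in>A. c p * (snd p \<bullet> u)) - (\<Sum>p\<in>A. c p * (snd p \<bullet> fst p))"
    by (simp add: \<phi>_def inner_sum_right inner_diff_right inner_add_left sum_distrib_left
        scaleR_left.sum sum_subtractf sum.distrib algebra_simps)
  also have "\<dots> = (\<Sum>p\<in>A. c p * (snd p \<bullet> u)) - (\<Sum>p\<in>A. c p * (snd p \<bullet> fst p))"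
    by (simp add: c1 c2)
  finally have gt: "(\<Sum>p\<in>A. c p * (snd p \<bullet> fst p)) < (\<Sum>p\<in>A. c p * (snd p \<bullet> u))"
    by simp
  \<comment> \<open>symmetrising over pairs turns the two weighted sums into one sum of monotonicity terms\<close>
  have cross: "(\<Sum>p\<in>A. \<Sum>q\<in>A. c p * c q * (snd p \<bullet> fst q)) = (\<Sum>p\<in>A. c p * (snd p \<bullet> u))"
    unfolding c2[symmetric] inner_sum_right by (simp add: sum_distrib_left mult_ac)
  have diag: "(\<Sum>p\<in>A. \<Sum>q\<in>A. c p * c q * (snd p \<bullet> fst p)) = (\<Sum>p\<in>A. c p * (snd p \<bullet> fst p))"
    using c1 by (simp add: sum_distrib_left[symmetric] sum_distrib_right[symmetric] mult.commute mult.left_commute)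
  have "0 \<le> (\<Sum>p\<in>A. \<Sum>q\<in>A. c p * c q * ((snd p - snd q) \<bullet> (fst p - fst q)))"
    by (intro sum_nonneg mult_nonneg_nonneg c0 mono)
  also have "\<dots> = (\<Sum>p\<in>A. \<Sum>q\<in>A. c p * c q * (snd p \<bullet> fst p))
      + (\<Sum>p\<in>A. \<Sum>q\<in>A. c q * c p * (snd q \<bullet> fst q))
      - (\<Sum>p\<in>A. \<Sum>q\<in>A. c p * c q * (snd p \<bullet> fst q))
      - (\<Sum>p\<in>A. \<Sum>q\<in>A. c q * c p * (snd q \<bullet> fst p))"
    unfolding sum.distrib[symmetric] sum_subtractf[symmetric]
    by (intro sum.cong refl) (simp add: inner_diff_left inner_diff_right algebra_simps)
  also have "(\<Sum>p\<in>A. \<Sum>q\<in>A. c q * c p * (snd q \<bullet> fst q))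
      = (\<Sum>p\<in>A. \<Sum>q\<in>A. c p * c q * (snd p \<bullet> fst p))"
    by (rule sum.swap)
  also have "(\<Sum>p\<in>A. \<Sum>q\<in>A. c q * c p * (snd q \<bullet> fst p))
      = (\<Sum>p\<in>A. \<Sum>q\<in>A. c p * c q * (snd p \<bullet> fst q))"
    by (rule sum.swap)
  finally show False
    using gt unfolding diag cross by simp
qed

text \<open>
  For \<open>c > 0\<close> each inequality confines \<open>u\<close> to a closed ball, so compactness passes from finitely
  many inequalities to all of them.
\<close>

lemma monotone_variational_inequality:
  fixes A :: "('a::euclidean_space \<times> 'a) set"
  assumes "0 < c"
    and mono: "\<And>p q. p \<in> A \<Longrightarrow> q \<in> A \<Longrightarrow> 0 \<le> (snd p - snd q) \<bullet> (fst p - fst q)"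
  shows "\<exists>u. \<forall>p\<in>A. (c *\<^sub>R u - x + snd p) \<bullet> (u - fst p) \<le> 0"
proof (cases "A = {}")
  case False
  then obtain p0 where p0: "p0 \<in> A" by auto
  define C where "C p = {u. (c *\<^sub>R u - x + snd p) \<bullet> (u - fst p) \<le> 0}" for p
  have closed: "closed (C p)" for p
    unfolding C_def by (intro closed_Collect_le continuous_intros)
  have "C p0 \<subseteq> cball (fst p0) (norm (c *\<^sub>R fst p0 - x + snd p0) / c)"
  proof
    fix u assume "u \<in> C p0"
    then have "c * (norm (u - fst p0))\<^sup>2 \<le> - ((c *\<^sub>R fst p0 - x + snd p0) \<bullet> (u - fst p0))"
      unfolding C_def power2_norm_eq_inner
      by (simp add: inner_diff_left inner_diff_right inner_add_left inner_commute algebra_simps)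
    also have "\<dots> \<le> norm (c *\<^sub>R fst p0 - x + snd p0) * norm (u - fst p0)"
      using Cauchy_Schwarz_ineq2[of "c *\<^sub>R fst p0 - x + snd p0" "u - fst p0"] by linarith
    finally have "c * norm (u - fst p0) \<le> norm (c *\<^sub>R fst p0 - x + snd p0)"
      by (cases "norm (u - fst p0) = 0") (simp_all add: power2_eq_square mult.assoc[symmetric])
    then show "u \<in> cball (fst p0) (norm (c *\<^sub>R fst p0 - x + snd p0) / c)"
      using \<open>0 < c\<close> by (simp add: dist_norm norm_minus_commute field_simps)
  qed
  then have "compact (C p0)"
    using closed bounded_cball bounded_subset compact_eq_bounded_closed by blast
  moreover have "closed D" if "D \<in> C ` A" for D
    using closed that by auto
  moreover have "C p0 \<inter> \<Inter>D \<noteq> {}" if "finite D" "D \<subseteq> C ` A" for D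
  proof -
    from that obtain B where B: "B \<subseteq> A" "finite B" "D = C ` B"
      by (meson finite_subset_image)
    have "\<exists>u. \<forall>p\<in>insert p0 B. (c *\<^sub>R u - x + snd p) \<bullet> (u - fst p) \<le> 0"
      using B p0 by (intro monotone_finite_variational_inequality mono continuous_intros) auto
    then show ?thesis
      unfolding B C_def by blast
  qed
  ultimately have "C p0 \<inter> \<Inter>(C ` A) \<noteq> {}"
    by (rule compact_imp_fip)
  then obtain u where "\<forall>p\<in>A. u \<in> C p"
    by blast
  then show ?thesis
    by (auto simp: C_def)
qed simp

text \<open>
  Minty's theorem: the operator with graph \<open>{(u, w + \<rho> u). u \<in> T w}\<close> is monotone, and the previous
  lemma provides a pair \<open>(w, u)\<close> with \<open>w + l u = x\<close> that is monotonically related to this graph.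
  Hence adding \<open>(w, u)\<close> to the graph of \<open>T\<close> keeps it co-hypomonotone, and maximality says that the
  pair was there already.
\<close>

lemma resolvent_nonempty:
  fixes T :: "'a::euclidean_space \<Rightarrow> 'a set"
  assumes "maximally_co_hypomonotone \<rho> T" "\<rho> < l"
  shows "\<exists>w. w \<in> resolvent l T x"
proof -
  have T: "(u - v) \<bullet> (w - w') \<ge> - \<rho> * (norm (u - v))\<^sup>2" if "u \<in> T w" "v \<in> T w'" for u v w w'
    using assms(1) that
    unfolding maximally_co_hypomonotone_def co_hypomonotone_def graph_def by auto
  define A where "A = {(u, w + \<rho> *\<^sub>R u) |u w. u \<in> T w}"
  have "\<exists>u. \<forall>p\<in>A. ((l - \<rho>) *\<^sub>R u - x + snd p) \<bullet> (u - fst p) \<le> 0"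
  proof (rule monotone_variational_inequality)
    fix p q assume "p \<in> A" "q \<in> A"
    then obtain u w v w' where "u \<in> T w" "v \<in> T w'"
      and pq: "p = (u, w + \<rho> *\<^sub>R u)" "q = (v, w' + \<rho> *\<^sub>R v)"
      unfolding A_def by auto
    with T have "(u - v) \<bullet> (w - w') \<ge> - \<rho> * (norm (u - v))\<^sup>2" by blast
    then show "0 \<le> (snd p - snd q) \<bullet> (fst p - fst q)"
      unfolding pq power2_norm_eq_inner
      by (simp add: inner_diff_left inner_diff_right inner_add_left inner_commute algebra_simps)
  qed (use assms(2) in simp)
  then obtain u where u: "\<And>p. p \<in> A \<Longrightarrow> ((l - \<rho>) *\<^sub>R u - x + snd p) \<bullet> (u - fst p) \<le> 0"
    by auto
  define w where "w = x - l *\<^sub>R u"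
  have new: "(u - v) \<bullet> (w - w') \<ge> - \<rho> * (norm (u - v))\<^sup>2" if "v \<in> T w'" for v w'
  proof -
    have "(v, w' + \<rho> *\<^sub>R v) \<in> A"
      using that unfolding A_def by blast
    from u[OF this] show ?thesis
      unfolding w_def power2_norm_eq_inner
      by (simp add: inner_diff_left inner_diff_right inner_add_left inner_commute algebra_simps)
  qed
  have new': "(v - u) \<bullet> (w' - w) \<ge> - \<rho> * (norm (v - u))\<^sup>2" if "v \<in> T w'" for v w'
    using new[OF that]
    by (metis inner_minus_left inner_minus_right minus_diff_eq minus_minus norm_minus_commute)
  define S where "S = (\<lambda>a. if a = w then insert u (T w) else T a)"
  have S: "v \<in> S a \<longleftrightarrow> v \<in> T a \<or> a = w \<and> v = u" for a v
    by (auto simp: S_def)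
  have "(v - v') \<bullet> (a - a') \<ge> - \<rho> * (norm (v - v'))\<^sup>2" if "v \<in> S a" "v' \<in> S a'" for v v' a a'
    using that T[of v a v' a'] new[of v' a'] new'[of v a] unfolding S by auto
  then have "co_hypomonotone \<rho> S"
    unfolding co_hypomonotone_def graph_def by blast
  moreover have "graph T \<subseteq> graph S" "(w, u) \<in> graph S"
    unfolding graph_def S_def by auto
  ultimately have "(w, u) \<in> graph T"
    using assms(1) unfolding maximally_co_hypomonotone_def by blast
  moreover have "x = w + l *\<^sub>R u"
    by (simp add: w_def)
  ultimately have "w \<in> resolvent l T x"
    unfolding resolvent_def graph_def by blast
  then show ?thesis ..
qed

text \<open>
  From \<open>a - b = (w - w') + l (u - v)\<close>, expanding the square leaves
  \<open>\<parallel>w - w'\<parallel>\<^sup>2 + l (l - 2 \<rho>) \<parallel>u - v\<parallel>\<^sup>2\<close> as a lower bound. Taking \<open>a = b\<close>, the resolvent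
  has at most one point.
\<close>

lemma resolvent_nonexpansive:
  assumes "co_hypomonotone \<rho> T" "0 < l" "2 * \<rho> \<le> l"
    and "w \<in> resolvent l T a" "w' \<in> resolvent l T b"
  shows "norm (w - w') \<le> norm (a - b)"
proof -
  obtain u v where uv: "u \<in> T w" "a = w + l *\<^sub>R u" "v \<in> T w'" "b = w' + l *\<^sub>R v"
    using assms(4,5) unfolding resolvent_def by auto
  then have "(u - v) \<bullet> (w - w') \<ge> - \<rho> * (norm (u - v))\<^sup>2"
    using assms(1) unfolding co_hypomonotone_def graph_def by auto
  then have "2 * l * ((u - v) \<bullet> (w - w')) \<ge> 2 * l * (- \<rho> * (norm (u - v))\<^sup>2)"
    using \<open>0 < l\<close> by (intro mult_left_mono) auto
  moreover have "0 \<le> l * (l - 2 * \<rho>) * (norm (u - v))\<^sup>2"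
    using assms(2,3) by simp
  moreover have "a - b = (w - w') + l *\<^sub>R (u - v)"
    using uv by (simp add: algebra_simps)
  then have "(norm (a - b))\<^sup>2 = (norm (w - w'))\<^sup>2 + 2 * l * ((u - v) \<bullet> (w - w'))
      + l\<^sup>2 * (norm (u - v))\<^sup>2"
    by (simp only: power2_norm_eq_inner inner_add_left inner_add_right inner_scaleR_left
        inner_scaleR_right inner_commute[of "w - w'" "u - v"]) (simp add: power2_eq_square algebra_simps)
  ultimately have "(norm (w - w'))\<^sup>2 \<le> (norm (a - b))\<^sup>2"
    by (simp add: power2_eq_square algebra_simps)
  then show ?thesis
    by (simp add: power2_le_iff_abs_le)
qed

locale co_hypomonotone_resolvent =
  fixes T :: "'a::euclidean_space \<Rightarrow> 'a set" and \<rho> l :: real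
  assumes maximal: "maximally_co_hypomonotone \<rho> T"
    and l_bounds: "0 < l" "\<rho> < l" "2 * \<rho> \<le> l"
begin

definition J where "J a = the_elem (resolvent l T a)"

lemma co_hypomonotone: "co_hypomonotone \<rho> T"
  using maximal unfolding maximally_co_hypomonotone_def by simp

lemma resolvent_eq: "resolvent l T a = {J a}"
proof -
  obtain w where w: "w \<in> resolvent l T a"
    using resolvent_nonempty maximal l_bounds by blast
  have "w' = w" if "w' \<in> resolvent l T a" for w'
    using resolvent_nonexpansive[OF co_hypomonotone l_bounds(1,3) that w] by simp
  with w have "resolvent l T a = {w}" by blast
  then show ?thesis by (simp add: J_def)
qed

lemma J_nonexpansive: "norm (J a - J b) \<le> norm (a - b)"
  by (rule resolvent_nonexpansive[OF co_hypomonotone l_bounds(1,3)]) (simp_all add: resolvent_eq)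

lemma continuous_on_J [continuous_intros]:
  assumes "continuous_on X f" shows "continuous_on X (\<lambda>x. J (f x))"
proof -
  have "1-lipschitz_on UNIV J"
    by (rule lipschitz_onI) (simp_all add: dist_norm J_nonexpansive)
  then have "continuous_on UNIV J"
    by (rule lipschitz_on_continuous_on)
  then show ?thesis
    by (rule continuous_on_compose2[OF _ assms]) simp
qed

lemma fbs_residual_J: "fbs_residual l T v x = (1 / l) *\<^sub>R (x - J (x - l *\<^sub>R v))"
  by (simp add: fbs_residual_def J_def)

text \<open>
  The residual is the sum of \<open>v\<close> and an element of \<open>T\<close> at the resolvent point, which is the form in
  which co-hypomonotonicity can be applied to it.
\<close>

lemma fbs_residual_in: "fbs_residual l T v x - v \<in> T (x - l *\<^sub>R fbs_residual l T v x)"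
proof -
  have "J (x - l *\<^sub>R v) \<in> resolvent l T (x - l *\<^sub>R v)"
    by (simp add: resolvent_eq)
  then obtain u where u: "u \<in> T (J (x - l *\<^sub>R v))" "x - l *\<^sub>R v = J (x - l *\<^sub>R v) + l *\<^sub>R u"
    unfolding resolvent_def by auto
  have J: "J (x - l *\<^sub>R v) = x - l *\<^sub>R fbs_residual l T v x"
    using l_bounds(1) by (simp add: fbs_residual_J)
  have "l *\<^sub>R u = l *\<^sub>R (fbs_residual l T v x - v)"
    using u(2) unfolding J by (simp add: algebra_simps)
  then have "u = fbs_residual l T v x - v"
    using l_bounds(1) by simp
  with u(1) J show ?thesis by simp
qed

text \<open>
  Nonexpansiveness of the resolvent passes the error of an estimator of \<open>F x\<close> on to the residual
  without amplification.
\<close>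

lemma fbs_residual_diff_le:
  "norm (fbs_residual l T v x - fbs_residual l T v' x) \<le> norm (v - v')"
proof -
  have "fbs_residual l T v x - fbs_residual l T v' x
      = (1 / l) *\<^sub>R (J (x - l *\<^sub>R v') - J (x - l *\<^sub>R v))"
    by (simp add: fbs_residual_J algebra_simps)
  also have "norm \<dots> \<le> \<bar>1 / l\<bar> * norm ((x - l *\<^sub>R v') - (x - l *\<^sub>R v))"
    unfolding norm_scaleR using l_bounds(1) by (intro mult_mono J_nonexpansive) auto
  also have "(x - l *\<^sub>R v') - (x - l *\<^sub>R v) = l *\<^sub>R (v - v')"
    by (simp add: algebra_simps)
  finally show ?thesis using l_bounds(1) by simp
qed

lemma FBS_eq_0_iff: "FBS l F T x = 0 \<longleftrightarrow> x \<in> zer (op_plus F T)"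
proof
  assume "FBS l F T x = 0"
  then have "- F x \<in> T x"
    using fbs_residual_in[of "F x" x] by simp
  then show "x \<in> zer (op_plus F T)"
    unfolding zer_def op_plus_def by force
next
  assume "x \<in> zer (op_plus F T)"
  then have "- F x \<in> T x"
    unfolding zer_def op_plus_def by (auto simp: add_eq_0_iff)
  then have "x \<in> resolvent l T (x - l *\<^sub>R F x)"
    unfolding resolvent_def by force
  then show "FBS l F T x = 0"
    by (simp add: resolvent_eq fbs_residual_J)
qed

text \<open>
  Write \<open>g, f, d\<close> for the differences of the residuals, of the values of \<open>F\<close> and of the points.
  Co-hypomonotonicity bounds \<open>\<langle>g, d\<rangle>\<close> below by \<open>\<langle>f, d\<rangle>\<close> plus a quadratic form in \<open>f\<close> and \<open>g\<close>. Together
  with the \<open>(1 / K) \<parallel>f\<parallel>\<^sup>2\<close> that is split off from \<open>\<langle>f, d\<rangle>\<close>, this form is minimised over \<open>f\<close> by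
  completing the square, and \<open>b\<close> is the coefficient of \<open>\<parallel>g\<parallel>\<^sup>2\<close> at the minimum.
\<close>

lemma FBS_co_coercive:
  assumes "0 < K" "K * \<rho> < 1"
  defines "b \<equiv> (l * (4 - K * l) - 4 * \<rho>) / (4 * (1 - \<rho> * K))"
  shows "b * (norm (FBS l F T x - FBS l F T y))\<^sup>2
      + ((F x - F y) \<bullet> (x - y) - (1 / K) * (norm (F x - F y))\<^sup>2)
    \<le> (FBS l F T x - FBS l F T y) \<bullet> (x - y)"
proof -
  define g f d where "g = FBS l F T x - FBS l F T y" and "f = F x - F y" and "d = x - y"
  have "(FBS l F T x - F x - (FBS l F T y - F y)) \<bullet> (x - l *\<^sub>R FBS l F T x - (y - l *\<^sub>R FBS l F T y))
      \<ge> - \<rho> * (norm (FBS l F T x - F x - (FBS l F T y - F y)))\<^sup>2"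
    using co_hypomonotone fbs_residual_in[of "F x" x] fbs_residual_in[of "F y" y]
    unfolding co_hypomonotone_def graph_def by auto
  moreover have "FBS l F T x - F x - (FBS l F T y - F y) = g - f"
    "x - l *\<^sub>R FBS l F T x - (y - l *\<^sub>R FBS l F T y) = d - l *\<^sub>R g"
    by (simp_all add: g_def f_def d_def algebra_simps)
  ultimately have 1: "(g - f) \<bullet> (d - l *\<^sub>R g) \<ge> - \<rho> * (norm (g - f))\<^sup>2"
    by simp
  define m where "m = 1 / K - \<rho>"
  have m: "m > 0" using assms(1,2) by (simp add: m_def field_simps)
  have b: "b = l - \<rho> - (l - 2 * \<rho>)\<^sup>2 / (4 * m)"
    using assms(1,2) by (simp add: b_def m_def power2_eq_square) (simp add: divide_simps, simp add: algebra_simps)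
  have "0 \<le> m * (norm (f - ((l - 2 * \<rho>) / (2 * m)) *\<^sub>R g))\<^sup>2"
    using m by simp
  also have "\<dots> = m * (f \<bullet> f) - (l - 2 * \<rho>) * (f \<bullet> g) + ((l - 2 * \<rho>)\<^sup>2 / (4 * m)) * (g \<bullet> g)"
    using m unfolding power2_norm_eq_inner
    by (simp add: inner_diff_left inner_diff_right inner_commute power2_eq_square) (simp add: field_simps)
  finally have 2: "0 \<le> m * (f \<bullet> f) - (l - 2 * \<rho>) * (f \<bullet> g) + (l - \<rho> - b) * (g \<bullet> g)"
    unfolding b by simp
  have "b * (g \<bullet> g) + (f \<bullet> d - (1 / K) * (f \<bullet> f)) \<le> g \<bullet> d"
    using 1 2 unfolding m_def power2_norm_eq_inner
    by (simp add: inner_diff_left inner_diff_right inner_commute algebra_simps)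
  then show ?thesis
    by (simp add: power2_norm_eq_inner g_def f_def d_def)
qed

end

section \<open>Averaged co-coercive operators\<close>

lemma norm_add_sq_le:
  fixes a b :: "'a::real_inner"
  shows "(norm (a + b))\<^sup>2 \<le> 2 * (norm a)\<^sup>2 + 2 * (norm b)\<^sup>2"
proof -
  have "0 \<le> (norm (a - b))\<^sup>2" by simp
  then show ?thesis
    by (simp add: power2_norm_eq_inner inner_diff_left inner_diff_right inner_add_left
        inner_add_right inner_commute)
qed

text \<open>
  Jensen's inequality, obtained from the nonnegativity of the variance of the differences. In the
  expectation setting the bounded variance supplies the square integrability.
\<close>

lemma norm_mean_diff_le_mean_sq_diff:
  assumes "valid_model S" "bounded_variance S"
  shows "(norm (mean_op S x - mean_op S y))\<^sup>2 \<le> mean_sq_diff S x y"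
proof (cases S)
  case (Finite_Sum n Fs)
  then have n: "real n > 0"
    using assms(1) by simp
  define h m where "h i = Fs i x - Fs i y" and "m = mean_op S x - mean_op S y" for i
  have m: "real n *\<^sub>R m = (\<Sum>i=1..n. h i)"
    using n Finite_Sum by (simp add: m_def h_def sum_subtractf scaleR_diff_right)
  have "0 \<le> (\<Sum>i=1..n. (norm (h i - m))\<^sup>2)"
    by (simp add: sum_nonneg)
  also have "\<dots> = (\<Sum>i=1..n. (norm (h i))\<^sup>2) - 2 * (m \<bullet> (\<Sum>i=1..n. h i)) + real n * (m \<bullet> m)"
    by (simp add: power2_norm_eq_inner inner_diff_left inner_diff_right inner_sum_right
        sum_subtractf sum.distrib sum_distrib_left inner_commute algebra_simps)
  also have "\<dots> = (\<Sum>i=1..n. (norm (h i))\<^sup>2) - real n * (m \<bullet> m)"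
    unfolding m[symmetric] by simp
  finally show ?thesis
    using n Finite_Sum by (simp add: m_def h_def power2_norm_eq_inner field_simps)
next
  case (Expectation D bF)
  interpret prob_space D
    using assms(1) Expectation by simp
  \<comment> \<open>integrability of the square is known for the centred samples only, hence the detour through \<open>h - m\<close>\<close>
  define h m where "h \<xi> = bF x \<xi> - bF y \<xi>" and "m = mean_op S x - mean_op S y" for \<xi>
  have int: "integrable D (bF u)" for u
    using assms(1) Expectation by simp
  have int_sq: "integrable D (\<lambda>\<xi>. (norm (bF u \<xi> - mean_op S u))\<^sup>2)" for u
  proof -
    obtain \<sigma> where "(\<integral>\<^sup>+\<xi>. ennreal ((norm (bF u \<xi> - mean_op S u))\<^sup>2) \<partial>D) \<le> ennreal (\<sigma>\<^sup>2)"
      using assms(2) Expectation by auto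
    then show ?thesis
      using int[of u] by (intro integrableI_bounded) (auto intro: le_less_trans)
  qed
  have m: "m = (LINT \<xi>|D. h \<xi>)"
    using Expectation int by (simp add: m_def h_def)
  have hm: "integrable D (\<lambda>\<xi>. (norm (h \<xi> - m))\<^sup>2)"
  proof (rule Bochner_Integration.integrable_bound)
    show "integrable D (\<lambda>\<xi>. 2 * (norm (bF x \<xi> - mean_op S x))\<^sup>2 + 2 * (norm (bF y \<xi> - mean_op S y))\<^sup>2)"
      using int_sq by simp
    show "(\<lambda>\<xi>. (norm (h \<xi> - m))\<^sup>2) \<in> borel_measurable D"
      using int unfolding h_def by measurable
    have le: "(norm (h \<xi> - m))\<^sup>2 \<le> 2 * (norm (bF x \<xi> - mean_op S x))\<^sup>2
        + 2 * (norm (bF y \<xi> - mean_op S y))\<^sup>2" for \<xi>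
    proof -
      have eq: "h \<xi> - m = (bF x \<xi> - mean_op S x) + - (bF y \<xi> - mean_op S y)"
        by (simp add: h_def m_def)
      show ?thesis
        unfolding eq
        using norm_add_sq_le[of "bF x \<xi> - mean_op S x" "- (bF y \<xi> - mean_op S y)"]
        by (simp only: norm_minus_cancel)
    qed
    show "AE \<xi> in D. norm ((norm (h \<xi> - m))\<^sup>2)
        \<le> norm (2 * (norm (bF x \<xi> - mean_op S x))\<^sup>2 + 2 * (norm (bF y \<xi> - mean_op S y))\<^sup>2)"
      using le by simp
  qed
  have hint: "integrable D h"
    using int unfolding h_def by simp
  have "(LINT \<xi>|D. (norm (h \<xi>))\<^sup>2) = (LINT \<xi>|D. (norm (h \<xi> - m))\<^sup>2 + 2 * (m \<bullet> h \<xi>) - m \<bullet> m)"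
    by (intro Bochner_Integration.integral_cong refl)
      (simp add: power2_norm_eq_inner inner_diff_left inner_diff_right inner_commute)
  also have "\<dots> = (LINT \<xi>|D. (norm (h \<xi> - m))\<^sup>2) + 2 * (m \<bullet> m) - m \<bullet> m"
    using hm hint by (simp add: prob_space flip: m)
  also have "\<dots> \<ge> m \<bullet> m"
    by (simp add: integral_nonneg_AE)
  finally show ?thesis
    using Expectation by (simp add: h_def m_def power2_norm_eq_inner)
qed

lemma mean_op_lipschitz:
  assumes "valid_model S" "bounded_variance S" "0 < L" "average_co_coercive L S"
  shows "norm (mean_op S x - mean_op S y) \<le> L * norm (x - y)"
proof -
  let ?f = "norm (mean_op S x - mean_op S y)"
  have "(1 / L) * mean_sq_diff S x y \<le> (mean_op S x - mean_op S y) \<bullet> (x - y)"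
    using assms(4) unfolding average_co_coercive_def by blast
  then have "mean_sq_diff S x y \<le> L * ((mean_op S x - mean_op S y) \<bullet> (x - y))"
    using assms(3) by (simp add: field_simps)
  also have "\<dots> \<le> L * (?f * norm (x - y))"
    using assms(3) by (intro mult_left_mono norm_cauchy_schwarz) auto
  finally have "?f\<^sup>2 \<le> ?f * (L * norm (x - y))"
    using norm_mean_diff_le_mean_sq_diff[OF assms(1,2), of x y] by (simp add: mult_ac)
  then show ?thesis
    using assms(3) by (cases "?f = 0") (simp_all add: power2_eq_square)
qed

lemma continuous_on_mean_op:
  assumes "valid_model S" "bounded_variance S" "0 < L" "average_co_coercive L S"
  shows "continuous_on X (mean_op S)"
proof -
  have "L-lipschitz_on X (mean_op S)"
    using mean_op_lipschitz[OF assms] assms(3) by (intro lipschitz_onI) (auto simp: dist_norm)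
  then show ?thesis
    by (rule lipschitz_on_continuous_on)
qed

text \<open>
  Of the co-coercivity constant \<open>1 / L = (K - L) / (L K) + 1 / K\<close> the second part is spent, through
  Jensen's inequality, on \<open>\<parallel>F x - F y\<parallel>\<^sup>2\<close>; the first part keeps control of the individual samples.
\<close>

lemma mean_sq_diff_le_excess:
  assumes "valid_model S" "bounded_variance S" "0 < L" "average_co_coercive L S" "L < K"
  shows "(K - L) / (L * K) * mean_sq_diff S x y
    \<le> (mean_op S x - mean_op S y) \<bullet> (x - y) - (1 / K) * (norm (mean_op S x - mean_op S y))\<^sup>2"
proof -
  have "(K - L) / (L * K) = 1 / L - 1 / K"
    using assms(3,5) by (simp add: field_simps)
  moreover have "(1 / K) * (norm (mean_op S x - mean_op S y))\<^sup>2 \<le> (1 / K) * mean_sq_diff S x y"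
    using assms(3,5) norm_mean_diff_le_mean_sq_diff[OF assms(1,2)] by (intro mult_left_mono) auto
  moreover have "(1 / L) * mean_sq_diff S x y \<le> (mean_op S x - mean_op S y) \<bullet> (x - y)"
    using assms(4) unfolding average_co_coercive_def by blast
  ultimately show ?thesis
    by (simp add: left_diff_distrib)
qed

lemma mean_sq_diff_nonneg: "0 \<le> mean_sq_diff S x y"
  by (cases S) (simp_all add: sum_nonneg)

section \<open>The energy of the accelerated iteration\<close>

text \<open>
  An accelerated fixed point iteration for a \<open>\<beta>bar\<close>-co-coercive operator \<open>G\<close>. The slack \<open>Q\<close> in
  the co-coercivity is kept as a parameter because it has to pay for the variance later. By
  \<open>\<beta> (1 + \<mu>) \<le> \<beta>bar\<close> there is a surplus of \<open>\<beta> \<mu> \<parallel>G x - G y\<parallel>\<^sup>2\<close> over \<open>\<beta>\<close>-co-coercivity, against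
  which perturbations of \<open>G\<close> are weighed.
\<close>

locale fast_krasnoselskii_mann =
  fixes G :: "'a::euclidean_space \<Rightarrow> 'a" and Q :: "'a \<Rightarrow> 'a \<Rightarrow> real" and \<beta> \<beta>bar \<mu> r :: real
  assumes mu: "0 < \<mu>" "\<mu> < 2 / 3" and r: "2 + 1 / \<mu> \<le> r"
    and beta: "0 < \<beta>" "\<beta> * (1 + \<mu>) \<le> \<beta>bar"
    and Q_nonneg: "0 \<le> Q a b"
    and co_coercive: "\<beta>bar * (norm (G a - G b))\<^sup>2 + Q a b \<le> (G a - G b) \<bullet> (a - b)"
begin

definition t where "t k = \<mu> * (real k + r)"
definition \<eta> where "\<eta> k = 2 * \<beta> * (t k - 1) / (t k - \<mu> / 2)"
text \<open>
  The weight \<open>s\<close> is the factor by which the co-coercivity inequality between consecutive iterates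
  is multiplied. The weight \<open>c\<close> is chosen such that the step of \<open>z\<close> cancels the term
  \<open>(1 - \<mu>) \<langle>G x, x - z\<rangle>\<close> that the first part of the energy leaves behind.
\<close>

definition s where "s k = t k * (t k - 1)"
definition c where "c k = (1 - \<mu>) / (\<mu> * \<eta> k)"

text \<open>
  The factor \<open>t k - \<mu>\<close> is \<open>t (k - 1)\<close>, written so that \<open>k = 0\<close> is no special case.
\<close>

definition energy :: "'a \<Rightarrow> nat \<Rightarrow> 'a \<Rightarrow> 'a \<Rightarrow> real" where
  "energy p k x z = (t k - \<mu>) * (G x \<bullet> (x - z)) + \<beta> * ((t k - \<mu>) * (t k - \<mu> - 1)) * (norm (G x))\<^sup>2
     + c k * (norm (z - p))\<^sup>2"

text \<open>
  The lower bound on \<open>r\<close> says precisely that \<open>t (-2) = \<mu> (r - 2) \<ge> 1\<close>.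
\<close>

lemma t_ge: "\<mu> * (real k + 2) + 1 \<le> t k"
proof -
  have "\<mu> * (2 + 1 / \<mu>) \<le> \<mu> * r"
    using r mu by (intro mult_left_mono) auto
  then have "2 * \<mu> + 1 \<le> \<mu> * r"
    using mu(1) by (simp add: distrib_left)
  then show ?thesis
    by (simp add: t_def algebra_simps)
qed

lemma t_ge_const: "1 + 2 * \<mu> \<le> t k"
proof -
  have "0 \<le> \<mu> * real k" using mu by simp
  then show ?thesis using t_ge[of k] by (simp add: algebra_simps)
qed

lemma t_Suc: "t (Suc k) = t k + \<mu>"
  by (simp add: t_def algebra_simps)

lemma s_pos: "0 < s k"
  using t_ge_const[of k] mu by (simp add: s_def)

lemma s_ge: "\<mu>\<^sup>2 * (real k + 1)\<^sup>2 \<le> s k"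
proof -
  have "\<mu> * (real k + 1) \<le> t k - 1"
    using t_ge[of k] mu by (simp add: algebra_simps)
  moreover have "0 \<le> \<mu> * (real k + 1)" using mu by simp
  ultimately have "(\<mu> * (real k + 1)) * (\<mu> * (real k + 1)) \<le> t k * (t k - 1)"
    by (intro mult_mono) auto
  then show ?thesis
    by (simp add: s_def power2_eq_square mult_ac)
qed

lemma eta_eq: "(t k - \<mu> / 2) * \<eta> k = 2 * \<beta> * (t k - 1)"
  using t_ge_const[of k] mu by (simp add: \<eta>_def)

lemma eta_pos: "0 < \<eta> k"
  using t_ge_const[of k] mu beta by (simp add: \<eta>_def)

text \<open>
  The step sizes increase to \<open>2 \<beta>\<close>, with a gap of order \<open>1 / t k\<close>.
\<close>

lemma eta_gap: "2 * \<beta> - \<eta> k = 2 * \<beta> * (1 - \<mu> / 2) / (t k - \<mu> / 2)"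
  using t_ge_const[of k] mu by (simp add: \<eta>_def field_simps)

lemma eta_le: "\<eta> k \<le> 2 * \<beta>"
proof -
  have "0 \<le> 2 * \<beta> - \<eta> k"
    unfolding eta_gap using t_ge_const[of k] mu beta by simp
  then show ?thesis by simp
qed

lemma eta_mono: "\<eta> k \<le> \<eta> (Suc k)"
proof -
  have "2 * \<beta> - \<eta> (Suc k) \<le> 2 * \<beta> - \<eta> k"
    unfolding eta_gap using t_ge_const[of k] mu beta by (intro divide_left_mono) (auto simp: t_Suc)
  then show ?thesis by simp
qed

lemma s_eta_gap: "2 * \<beta> * (1 - \<mu> / 2) * (t k - 1) \<le> s k * (2 * \<beta> - \<eta> k)"
    "s k * (2 * \<beta> - \<eta> k) \<le> 2 * \<beta> * t k"
proof -
  have pos: "0 < t k - \<mu> / 2" "0 < t k - 1" "0 < t k"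
    using t_ge_const[of k] mu by auto
  have eq: "s k * (2 * \<beta> - \<eta> k) = 2 * \<beta> * (1 - \<mu> / 2) * (t k - 1) * (t k / (t k - \<mu> / 2))"
    by (simp add: eta_gap s_def)
  have "1 \<le> t k / (t k - \<mu> / 2)"
    using pos mu by (simp add: field_simps)
  from mult_left_mono[OF this, of "2 * \<beta> * (1 - \<mu> / 2) * (t k - 1)"]
  show "2 * \<beta> * (1 - \<mu> / 2) * (t k - 1) \<le> s k * (2 * \<beta> - \<eta> k)"
    unfolding eq using mu beta pos by simp
  have eq: "s k * (2 * \<beta> - \<eta> k) = 2 * \<beta> * t k * ((1 - \<mu> / 2) * (t k - 1) / (t k - \<mu> / 2))"
    by (simp add: eta_gap s_def)
  have "(1 - \<mu> / 2) * (t k - 1) \<le> 1 * (t k - \<mu> / 2)"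
    using mu pos by (intro mult_mono) auto
  then have "(1 - \<mu> / 2) * (t k - 1) / (t k - \<mu> / 2) \<le> 1"
    using pos by simp
  from mult_left_mono[OF this, of "2 * \<beta> * t k"]
  show "s k * (2 * \<beta> - \<eta> k) \<le> 2 * \<beta> * t k"
    unfolding eq using pos beta by simp
qed

lemma c_mono: "c (Suc k) \<le> c k"
  unfolding c_def using mu eta_mono[of k] eta_pos[of k] eta_pos[of "Suc k"]
  by (intro divide_left_mono) auto

text \<open>
  A weight \<open>1 / (4 \<beta>)\<close> is what the square \<open>\<beta> a\<^sup>2 - a b + b\<^sup>2 / (4 \<beta>)\<close> consumes; the surplus is positive
  because \<open>\<mu> < 2 / 3\<close>.
\<close>

lemma c_ge: "1 / (4 * \<beta>) + (2 - 3 * \<mu>) / (4 * \<beta> * \<mu>) \<le> c k"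
proof -
  have "1 / (4 * \<beta>) + (2 - 3 * \<mu>) / (4 * \<beta> * \<mu>) = (1 - \<mu>) / (\<mu> * (2 * \<beta>))"
    using mu beta by (simp add: field_simps)
  also have "\<dots> \<le> c k"
    unfolding c_def using mu beta eta_le[of k] eta_pos[of k]
    by (intro divide_left_mono mult_left_mono mult_pos_pos) auto
  finally show ?thesis .
qed

lemma co_coercive_zero: "G p = 0 \<Longrightarrow> \<beta>bar * (norm (G a))\<^sup>2 \<le> G a \<bullet> (a - p)"
  using co_coercive[of a p] Q_nonneg[of a p] by simp

lemma beta_le: "\<beta> \<le> \<beta>bar"
proof -
  have "\<beta> * 1 \<le> \<beta> * (1 + \<mu>)"
    using beta mu by (intro mult_left_mono) auto
  from order_trans[OF this beta(2)] show ?thesis by simp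
qed

text \<open>
  A modulus of positive definiteness for the form \<open>\<beta> a\<^sup>2 - a b + c b\<^sup>2\<close> below the energy: half of the surplus
  of \<open>c\<close> over \<open>1 / (4 \<beta>)\<close> is left to \<open>b\<^sup>2\<close>, the other half frees a multiple of \<open>a\<^sup>2\<close>.
\<close>

definition \<delta> where
  "\<delta> = min ((2 - 3 * \<mu>) / (8 * \<beta> * \<mu>)) (\<beta> - 1 / (4 * (1 / (4 * \<beta>) + (2 - 3 * \<mu>) / (8 * \<beta> * \<mu>))))"

lemma delta_pos: "0 < \<delta>"
proof -
  define e where "e = (2 - 3 * \<mu>) / (8 * \<beta> * \<mu>)"
  have e: "0 < e" using mu beta by (simp add: e_def)
  have "1 / (4 * (1 / (4 * \<beta>) + e)) < \<beta>"
    using e beta by (simp add: field_simps add_pos_pos)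
  with e show ?thesis
    by (simp add: \<delta>_def flip: e_def)
qed

text \<open>
  Splitting \<open>x - z = (x - p) - (z - p)\<close>, co-coercivity at the zero \<open>p\<close> turns the energy into at least
  \<open>\<beta> a\<^sup>2 - a b + c b\<^sup>2\<close> with \<open>a = (t k - \<mu>) \<parallel>G x\<parallel>\<close> and \<open>b = \<parallel>z - p\<parallel>\<close>.
\<close>

lemma energy_lower_bound:
  assumes "G p = 0"
  shows "\<delta> * ((t k - \<mu>)\<^sup>2 * (norm (G x))\<^sup>2 + (norm (z - p))\<^sup>2) \<le> energy p k x z"
proof -
  define \<tau> a b where "\<tau> = t k - \<mu>" and "a = norm (G x)" and "b = norm (z - p)"
  have \<tau>: "1 + \<mu> \<le> \<tau>"
    using t_ge_const[of k] by (simp add: \<tau>_def)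
  define e where "e = (2 - 3 * \<mu>) / (8 * \<beta> * \<mu>)"
  define m where "m = 1 / (4 * \<beta>) + e"
  have e: "0 < e" using mu beta by (simp add: e_def)
  then have m: "0 < m" using beta by (simp add: m_def add_pos_pos)
  have \<delta>: "\<delta> \<le> e" "\<delta> \<le> \<beta> - 1 / (4 * m)"
    by (simp_all add: \<delta>_def m_def e_def)
  have c: "m + e \<le> c k"
  proof -
    have "m + e = 1 / (4 * \<beta>) + (2 - 3 * \<mu>) / (4 * \<beta> * \<mu>)"
      using mu beta by (simp add: m_def e_def field_simps)
    with c_ge[of k] show ?thesis by simp
  qed
  have "G x \<bullet> (x - z) = G x \<bullet> (x - p) - G x \<bullet> (z - p)"
    by (simp add: inner_diff_right)
  also have "\<dots> \<ge> \<beta> * a\<^sup>2 - a * b"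
    using co_coercive_zero[OF assms, of x] norm_cauchy_schwarz[of "G x" "z - p"] mult_right_mono[OF beta_le, of "a\<^sup>2"]
    by (simp add: a_def b_def)
  finally have "\<tau> * (\<beta> * a\<^sup>2 - a * b) \<le> \<tau> * (G x \<bullet> (x - z))"
    using \<tau> mu by (intro mult_left_mono) auto
  then have "\<tau> * (\<beta> * a\<^sup>2 - a * b) + \<beta> * (\<tau> * (\<tau> - 1)) * a\<^sup>2 + c k * b\<^sup>2 \<le> energy p k x z"
    by (simp add: energy_def \<tau>_def a_def b_def)
  moreover have "(m + e) * b\<^sup>2 \<le> c k * b\<^sup>2"
    using c by (intro mult_right_mono) auto
  moreover have "\<tau> * (\<beta> * a\<^sup>2 - a * b) + \<beta> * (\<tau> * (\<tau> - 1)) * a\<^sup>2 = \<beta> * (\<tau> * a)\<^sup>2 - (\<tau> * a) * b"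
    by (simp add: power2_eq_square algebra_simps)
  moreover have "(\<tau> * a) * b \<le> m * b\<^sup>2 + (\<tau> * a)\<^sup>2 / (4 * m)"
  proof -
    have "0 \<le> m * (b - \<tau> * a / (2 * m))\<^sup>2"
      using m by simp
    also have "\<dots> = m * b\<^sup>2 + (\<tau> * a)\<^sup>2 / (4 * m) - (\<tau> * a) * b"
      using m by (simp add: power2_eq_square field_simps)
    finally show ?thesis by simp
  qed
  moreover have "\<delta> * (\<tau> * a)\<^sup>2 \<le> (\<beta> - 1 / (4 * m)) * (\<tau> * a)\<^sup>2" "\<delta> * b\<^sup>2 \<le> e * b\<^sup>2"
    using \<delta> by (intro mult_right_mono; simp)+
  moreover have "(m + e) * b\<^sup>2 = m * b\<^sup>2 + e * b\<^sup>2"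
    "(\<beta> - 1 / (4 * m)) * (\<tau> * a)\<^sup>2 = \<beta> * (\<tau> * a)\<^sup>2 - (\<tau> * a)\<^sup>2 / (4 * m)"
    "\<delta> * (\<tau>\<^sup>2 * a\<^sup>2 + b\<^sup>2) = \<delta> * (\<tau> * a)\<^sup>2 + \<delta> * b\<^sup>2"
    by (simp_all add: distrib_right left_diff_distrib distrib_left power_mult_distrib)
  ultimately show ?thesis
    unfolding \<tau>_def[symmetric] a_def[symmetric] b_def[symmetric] by linarith
qed

lemma energy_nonneg:
  assumes "G p = 0"
  shows "0 \<le> energy p k x z"
proof -
  have "0 \<le> \<delta> * ((t k - \<mu>)\<^sup>2 * (norm (G x))\<^sup>2 + (norm (z - p))\<^sup>2)"
    using delta_pos by simp
  also note energy_lower_bound[OF assms]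
  finally show ?thesis .
qed

text \<open>
  Multiply the co-coercivity inequality between \<open>xn\<close> and \<open>x\<close> by \<open>s k = t k (t k - 1)\<close>. Both
  \<open>t k (xn - x)\<close> and \<open>(t k - 1) (xn - x)\<close> are gaps \<open>z - x\<close> and \<open>zn - xn\<close> up to multiples of the
  direction \<open>G x + \<epsilon>\<close>, and the step size \<open>\<eta> k\<close> makes the second multiple equal to
  \<open>2 \<beta> (t k - 1)\<close>. So the inequality compares the first parts of the energies, and polarisation of
  \<open>2 \<beta> \<langle>G xn, G x\<rangle>\<close> produces the second parts. What is left over are the error terms in \<open>\<epsilon>\<close>, shown
  here with explicit coefficients.
\<close>

lemma energy_step_explicit:
  assumes xn: "t k *\<^sub>R (xn - x) = z - x - (t k * \<eta> k) *\<^sub>R (G x + \<epsilon>)"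
    and zn: "zn = z - (\<mu> / 2 * \<eta> k) *\<^sub>R (G x + \<epsilon>)"
    and p: "G p = 0"
  shows "energy p (Suc k) xn zn + s k * Q xn x + \<beta> * (2 - 3 * \<mu>) * t k * (norm (G x))\<^sup>2
    \<le> energy p k x z + 3 * \<beta> * (norm (G x))\<^sup>2 + 2 * \<beta> * t k * (norm (G x) * norm \<epsilon>)
      + norm \<epsilon> * norm (z - p) + \<beta> * (norm \<epsilon>)\<^sup>2 + \<beta> / \<mu> * s k * (norm \<epsilon>)\<^sup>2"
proof -
  define \<tau> h d W where "\<tau> = t k" and "h = \<eta> k" and "d = xn - x" and "W = G x + \<epsilon>"
  have \<tau>: "1 + 2 * \<mu> \<le> \<tau>" and h: "0 < h" "h \<le> 2 * \<beta>"
    using t_ge_const eta_pos eta_le by (auto simp: \<tau>_def h_def)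
  have s: "s k = \<tau> * (\<tau> - 1)" "0 < s k"
    using s_pos by (auto simp: s_def \<tau>_def)
  have d1: "\<tau> *\<^sub>R d = z - x - (\<tau> * h) *\<^sub>R W"
    using xn by (simp add: \<tau>_def h_def d_def W_def)
  have "zn - xn = (\<tau> - 1) *\<^sub>R d + ((\<tau> - \<mu> / 2) * h) *\<^sub>R W"
    using d1 zn by (simp add: d_def W_def h_def algebra_simps)
  also have "(\<tau> - \<mu> / 2) * h = 2 * \<beta> * (\<tau> - 1)"
    using eta_eq by (simp add: \<tau>_def h_def)
  finally have d2: "zn - xn = (\<tau> - 1) *\<^sub>R d + (2 * \<beta> * (\<tau> - 1)) *\<^sub>R W" .
  \<comment> \<open>pair the two expressions of the step with \<open>G x\<close> and \<open>G xn\<close>, respectively\<close>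
  have i1: "\<tau> * (G x \<bullet> d) = - (G x \<bullet> (x - z)) - \<tau> * h * (G x \<bullet> W)"
    using arg_cong[OF d1, of "\<lambda>v. G x \<bullet> v"] by (simp add: inner_diff_right)
  have i2: "- (G xn \<bullet> (xn - zn)) = (\<tau> - 1) * (G xn \<bullet> d) + 2 * \<beta> * (\<tau> - 1) * (G xn \<bullet> W)"
    using arg_cong[OF d2, of "\<lambda>v. G xn \<bullet> v"] by (simp add: inner_diff_right inner_add_right)
  have "s k * (\<beta>bar * (norm (G xn - G x))\<^sup>2 + Q xn x) \<le> s k * ((G xn - G x) \<bullet> d)"
    using co_coercive[of xn x] s(2) by (intro mult_left_mono) (auto simp: d_def)
  also have "\<dots> = \<tau> * ((\<tau> - 1) * (G xn \<bullet> d)) - (\<tau> - 1) * (\<tau> * (G x \<bullet> d))"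
    by (simp add: s(1) inner_diff_left algebra_simps)
  also have "\<dots> = - (\<tau> * (G xn \<bullet> (xn - zn))) - s k * (2 * \<beta>) * (G xn \<bullet> W)
      + (\<tau> - 1) * (G x \<bullet> (x - z)) + s k * h * (G x \<bullet> W)"
  proof -
    have *: "(\<tau> - 1) * (G xn \<bullet> d) = - (G xn \<bullet> (xn - zn)) - 2 * \<beta> * (\<tau> - 1) * (G xn \<bullet> W)"
      using i2 by simp
    show ?thesis
      unfolding i1 * by (simp add: s(1) algebra_simps)
  qed
  finally have main: "\<tau> * (G xn \<bullet> (xn - zn)) \<le> (\<tau> - 1) * (G x \<bullet> (x - z))
      - s k * (2 * \<beta>) * (G xn \<bullet> W) + s k * h * (G x \<bullet> W)
      - s k * (\<beta>bar * (norm (G xn - G x))\<^sup>2) - s k * Q xn x"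
    by (simp add: algebra_simps)
  have cross: "- (2 * (G xn \<bullet> W)) + (norm (G xn))\<^sup>2
      = (norm (G xn - G x))\<^sup>2 - (norm (G x))\<^sup>2 - 2 * ((G xn - G x) \<bullet> \<epsilon>) - 2 * (G x \<bullet> \<epsilon>)"
    by (simp add: W_def power2_norm_eq_inner inner_diff_left inner_diff_right inner_add_right inner_commute)
  have GW: "G x \<bullet> W = (norm (G x))\<^sup>2 + G x \<bullet> \<epsilon>"
    by (simp add: W_def inner_add_right power2_norm_eq_inner)
  have "s k * (\<beta> * (- (2 * (G xn \<bullet> W)) + (norm (G xn))\<^sup>2)) + s k * h * (G x \<bullet> W)
     = s k * \<beta> * (norm (G xn - G x))\<^sup>2 - 2 * (s k * \<beta> * ((G xn - G x) \<bullet> \<epsilon>))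
       + (s k * \<beta> - s k * (2 * \<beta> - h)) * (norm (G x))\<^sup>2 - s k * (2 * \<beta> - h) * (G x \<bullet> \<epsilon>)"
    unfolding cross GW by (simp add: algebra_simps)
  with main have A: "\<tau> * (G xn \<bullet> (xn - zn)) + \<beta> * s k * (norm (G xn))\<^sup>2 + s k * Q xn x
     \<le> (\<tau> - 1) * (G x \<bullet> (x - z))
       - s k * ((\<beta>bar - \<beta>) * (norm (G xn - G x))\<^sup>2 + 2 * \<beta> * ((G xn - G x) \<bullet> \<epsilon>))
       + (s k * \<beta> - s k * (2 * \<beta> - h)) * (norm (G x))\<^sup>2 - s k * (2 * \<beta> - h) * (G x \<bullet> \<epsilon>)"
    by (simp add: algebra_simps)
  \<comment> \<open>the surplus \<open>\<beta>bar - \<beta> \<ge> \<beta> \<mu>\<close> of co-coercivity pays for \<open>\<langle>G xn - G x, \<epsilon>\<rangle>\<close>\<close>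
  have young: "- ((\<beta>bar - \<beta>) * (norm (G xn - G x))\<^sup>2 + 2 * \<beta> * ((G xn - G x) \<bullet> \<epsilon>)) \<le> \<beta> / \<mu> * (norm \<epsilon>)\<^sup>2"
  proof -
    have "0 \<le> \<beta> * \<mu> * (norm ((G xn - G x) + (1 / \<mu>) *\<^sub>R \<epsilon>))\<^sup>2"
      using mu beta by simp
    also have "\<dots> = \<beta> * \<mu> * (norm (G xn - G x))\<^sup>2 + 2 * \<beta> * ((G xn - G x) \<bullet> \<epsilon>) + \<beta> / \<mu> * (norm \<epsilon>)\<^sup>2"
    proof -
      have "(norm ((G xn - G x) + (1 / \<mu>) *\<^sub>R \<epsilon>))\<^sup>2 = (norm (G xn - G x))\<^sup>2
          + 2 / \<mu> * ((G xn - G x) \<bullet> \<epsilon>) + 1 / \<mu>\<^sup>2 * (norm \<epsilon>)\<^sup>2"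
        by (simp only: power2_norm_eq_inner inner_add_left inner_add_right inner_scaleR_left
            inner_scaleR_right inner_commute[of \<epsilon> "G xn - G x"])
          (simp add: power2_eq_square add_divide_distrib)
      then show ?thesis
        using mu(1) by (simp add: distrib_left power2_eq_square)
    qed
    finally have "- (2 * \<beta> * ((G xn - G x) \<bullet> \<epsilon>)) \<le> \<beta> * \<mu> * (norm (G xn - G x))\<^sup>2 + \<beta> / \<mu> * (norm \<epsilon>)\<^sup>2"
      by simp
    moreover have "\<beta> * \<mu> * (norm (G xn - G x))\<^sup>2 \<le> (\<beta>bar - \<beta>) * (norm (G xn - G x))\<^sup>2"
      using beta by (intro mult_right_mono) (auto simp: algebra_simps)
    ultimately show ?thesis by linarith
  qed
  have young_s: "- (s k * ((\<beta>bar - \<beta>) * (norm (G xn - G x))\<^sup>2 + 2 * \<beta> * ((G xn - G x) \<bullet> \<epsilon>)))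
      \<le> \<beta> / \<mu> * s k * (norm \<epsilon>)\<^sup>2"
    using mult_left_mono[OF young, of "s k"] s(2) by (simp add: algebra_simps)
  \<comment> \<open>linear terms in \<open>t k\<close>: the left-hand side loses \<open>1 + (2 - \<mu>)\<close>, the old weight of \<open>\<parallel>G x\<parallel>\<^sup>2\<close> only \<open>1 + 2 \<mu>\<close>\<close>
  have coefG: "(s k * \<beta> - s k * (2 * \<beta> - h)) * (norm (G x))\<^sup>2
     \<le> (\<beta> * ((\<tau> - \<mu>) * (\<tau> - \<mu> - 1)) - \<beta> * (2 - 3 * \<mu>) * \<tau> + 2 * \<beta>) * (norm (G x))\<^sup>2"
  proof (rule mult_right_mono)
    have "s k * \<beta> - s k * (2 * \<beta> - h) \<le> s k * \<beta> - 2 * \<beta> * (1 - \<mu> / 2) * (\<tau> - 1)"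
      using s_eta_gap(1)[of k] by (simp add: \<tau>_def h_def)
    also have "\<dots> = \<beta> * ((\<tau> - \<mu>) * (\<tau> - \<mu> - 1)) - \<beta> * (2 - 3 * \<mu>) * \<tau> + 2 * \<beta> - \<beta> * (\<mu>\<^sup>2 + 2 * \<mu>)"
      by (simp add: s(1) power2_eq_square algebra_simps)
    also have "\<dots> \<le> \<beta> * ((\<tau> - \<mu>) * (\<tau> - \<mu> - 1)) - \<beta> * (2 - 3 * \<mu>) * \<tau> + 2 * \<beta>"
      using mu beta by simp
    finally show "s k * \<beta> - s k * (2 * \<beta> - h) \<le> \<dots>" .
  qed simp
  have Ge: "- (s k * (2 * \<beta> - h) * (G x \<bullet> \<epsilon>)) \<le> 2 * \<beta> * \<tau> * (norm (G x) * norm \<epsilon>)"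
  proof -
    have "- (s k * (2 * \<beta> - h) * (G x \<bullet> \<epsilon>)) \<le> s k * (2 * \<beta> - h) * \<bar>G x \<bullet> \<epsilon>\<bar>"
      using mult_left_mono[of "- (G x \<bullet> \<epsilon>)" "\<bar>G x \<bullet> \<epsilon>\<bar>" "s k * (2 * \<beta> - h)"] s(2) h by auto
    also have "\<dots> \<le> (2 * \<beta> * \<tau>) * (norm (G x) * norm \<epsilon>)"
      using s_eta_gap(2)[of k] s(2) h \<tau> mu beta Cauchy_Schwarz_ineq2[of "G x" \<epsilon>]
      by - (rule mult_mono, auto simp: \<tau>_def h_def)
    finally show ?thesis .
  qed
  have ez: "- ((1 - \<mu>) * (\<epsilon> \<bullet> (z - p))) \<le> norm \<epsilon> * norm (z - p)"
  proof -
    have "- ((1 - \<mu>) * (\<epsilon> \<bullet> (z - p))) \<le> (1 - \<mu>) * \<bar>\<epsilon> \<bullet> (z - p)\<bar>"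
      using mult_left_mono[of "- (\<epsilon> \<bullet> (z - p))" "\<bar>\<epsilon> \<bullet> (z - p)\<bar>" "1 - \<mu>"] mu by auto
    also have "\<dots> \<le> 1 * (norm \<epsilon> * norm (z - p))"
      using mu Cauchy_Schwarz_ineq2[of \<epsilon> "z - p"] by (intro mult_mono) auto
    finally show ?thesis by simp
  qed
  have ch: "c k * h = (1 - \<mu>) / \<mu>"
    using mu h by (simp add: c_def h_def)
  have "c k * (norm (zn - p))\<^sup>2 = c k * (norm (z - p))\<^sup>2 - (c k * h) * \<mu> * (W \<bullet> (z - p))
      + (c k * h) * (\<mu>\<^sup>2 / 4 * h) * (norm W)\<^sup>2"
  proof -
    have "zn - p = (z - p) - (\<mu> / 2 * h) *\<^sub>R W"
      using zn by (simp add: h_def W_def)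
    then have eq: "(norm (zn - p))\<^sup>2 = (norm (z - p))\<^sup>2 - \<mu> * h * (W \<bullet> (z - p)) + (\<mu> / 2 * h)\<^sup>2 * (norm W)\<^sup>2"
      by (simp only: power2_norm_eq_inner inner_diff_left inner_diff_right inner_scaleR_left
          inner_scaleR_right inner_commute[of z W] inner_commute[of p W]) (simp add: power2_eq_square algebra_simps)
    show ?thesis
      unfolding eq by (simp add: power2_eq_square algebra_simps)
  qed
  also have "\<dots> = c k * (norm (z - p))\<^sup>2 - (1 - \<mu>) * (W \<bullet> (z - p)) + ((1 - \<mu>) * \<mu>) * (h / 4) * (norm W)\<^sup>2"
    unfolding ch using mu by (simp add: power2_eq_square field_simps)
  also have "W \<bullet> (z - p) = G x \<bullet> (x - p) - G x \<bullet> (x - z) + \<epsilon> \<bullet> (z - p)"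
    by (simp add: W_def inner_add_left inner_diff_right)
  \<comment> \<open>the multiple \<open>(1 - \<mu>)\<close> of \<open>\<langle>G x, x - z\<rangle>\<close> fits the factors \<open>t k - 1\<close> above and \<open>t k - \<mu>\<close> in the energy\<close>
  finally have zz: "c k * (norm (zn - p))\<^sup>2 = c k * (norm (z - p))\<^sup>2
      - (1 - \<mu>) * (G x \<bullet> (x - p)) + (1 - \<mu>) * (G x \<bullet> (x - z)) - (1 - \<mu>) * (\<epsilon> \<bullet> (z - p))
      + ((1 - \<mu>) * \<mu>) * (h / 4) * (norm W)\<^sup>2"
    by (simp add: algebra_simps)
  have WW: "((1 - \<mu>) * \<mu>) * (h / 4) * (norm W)\<^sup>2 \<le> \<beta> * (norm (G x))\<^sup>2 + \<beta> * (norm \<epsilon>)\<^sup>2"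
  proof -
    have "(norm W)\<^sup>2 \<le> 2 * (norm (G x))\<^sup>2 + 2 * (norm \<epsilon>)\<^sup>2"
      unfolding W_def by (rule norm_add_sq_le)
    moreover have "((1 - \<mu>) * \<mu>) * (h / 4) \<le> 1 * (\<beta> / 2)"
      using mu h mult_mono[of "1 - \<mu>" 1 \<mu> 1] by (intro mult_mono) auto
    ultimately have "((1 - \<mu>) * \<mu>) * (h / 4) * (norm W)\<^sup>2
        \<le> 1 * (\<beta> / 2) * (2 * (norm (G x))\<^sup>2 + 2 * (norm \<epsilon>)\<^sup>2)"
      using mu h beta by (intro mult_mono[of _ "1 * (\<beta> / 2)"]) auto
    then show ?thesis by (simp add: algebra_simps)
  qed
  have xp: "0 \<le> (1 - \<mu>) * (G x \<bullet> (x - p))"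
  proof -
    have "0 \<le> \<beta>bar * (norm (G x))\<^sup>2"
      using beta beta_le by simp
    with co_coercive_zero[OF p, of x] mu show ?thesis by simp
  qed
  have cn: "c (Suc k) * (norm (zn - p))\<^sup>2 \<le> c k * (norm (zn - p))\<^sup>2"
    by (intro mult_right_mono c_mono) auto
  have "energy p (Suc k) xn zn = \<tau> * (G xn \<bullet> (xn - zn)) + \<beta> * s k * (norm (G xn))\<^sup>2
      + c (Suc k) * (norm (zn - p))\<^sup>2"
    by (simp add: energy_def t_Suc \<tau>_def s_def)
  moreover have "energy p k x z = (\<tau> - \<mu>) * (G x \<bullet> (x - z))
      + \<beta> * ((\<tau> - \<mu>) * (\<tau> - \<mu> - 1)) * (norm (G x))\<^sup>2 + c k * (norm (z - p))\<^sup>2"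
    by (simp add: energy_def \<tau>_def)
  moreover have "(\<tau> - 1) * (G x \<bullet> (x - z)) + (1 - \<mu>) * (G x \<bullet> (x - z)) = (\<tau> - \<mu>) * (G x \<bullet> (x - z))"
    by (simp add: algebra_simps)
  moreover have "(\<beta> * ((\<tau> - \<mu>) * (\<tau> - \<mu> - 1)) - \<beta> * (2 - 3 * \<mu>) * \<tau> + 2 * \<beta>) * (norm (G x))\<^sup>2
     = \<beta> * ((\<tau> - \<mu>) * (\<tau> - \<mu> - 1)) * (norm (G x))\<^sup>2 - \<beta> * (2 - 3 * \<mu>) * \<tau> * (norm (G x))\<^sup>2
       + 2 * \<beta> * (norm (G x))\<^sup>2"
    by (simp add: left_diff_distrib distrib_right)
  ultimately show ?thesis
    using A young_s coefG Ge ez zz WW xp cn unfolding \<tau>_def[symmetric] by linarith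
qed

text \<open>
  The errors of lower order are bounded by \<open>K / s k\<close> times the energy; the factor \<open>4\<close> accounts for
  \<open>t k \<le> 2 (t k - \<mu>)\<close> and \<open>\<delta>\<close> for the lower bound of the energy.
\<close>

definition K where "K = 4 * (3 * \<beta> + \<beta> * \<mu> + \<mu> / (4 * \<beta>)) / \<delta>"

lemma K_nonneg: "0 \<le> K"
  using mu beta delta_pos by (simp add: K_def)

text \<open>
  To the \<open>\<beta> / \<mu>\<close> in the explicit estimate come three more: one from Young's inequality for
  \<open>t \<parallel>G x\<parallel> \<parallel>\<epsilon>\<parallel>\<close>, one from Young's inequality for \<open>\<parallel>\<epsilon>\<parallel> \<parallel>z - p\<parallel>\<close>, and one from \<open>\<beta> \<parallel>\<epsilon>\<parallel>\<^sup>2\<close>, as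
  \<open>\<mu> \<le> s k\<close>. The counterparts in the two Young inequalities are of the order of the energy divided
  by \<open>s k\<close> and make up, with \<open>3 \<beta> \<parallel>G x\<parallel>\<^sup>2\<close>, the summable growth factor \<open>K / s k\<close>.
\<close>

lemma energy_step:
  assumes xn: "t k *\<^sub>R (xn - x) = z - x - (t k * \<eta> k) *\<^sub>R (G x + \<epsilon>)"
    and zn: "zn = z - (\<mu> / 2 * \<eta> k) *\<^sub>R (G x + \<epsilon>)"
    and p: "G p = 0"
  shows "energy p (Suc k) xn zn + s k * Q xn x + \<beta> * (2 - 3 * \<mu>) * t k * (norm (G x))\<^sup>2
    \<le> (1 + K / s k) * energy p k x z + 4 * \<beta> / \<mu> * s k * (norm \<epsilon>)\<^sup>2"
proof -
  define \<tau> \<sigma> a b e where "\<tau> = t k" and "\<sigma> = s k" and "a = norm (G x)" and "b = norm (z - p)"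
    and "e = norm \<epsilon>"
  have \<tau>: "1 + 2 * \<mu> \<le> \<tau>" using t_ge_const by (simp add: \<tau>_def)
  have \<sigma>: "\<sigma> = \<tau> * (\<tau> - 1)" "0 < \<sigma>"
    using s_pos by (auto simp: s_def \<tau>_def \<sigma>_def)
  have \<sigma>\<mu>: "\<mu> \<le> \<sigma>"
    using mult_mono[of 1 \<tau> \<mu> "\<tau> - 1"] \<tau> mu by (simp add: \<sigma>)
  have t1: "3 * \<beta> * a\<^sup>2 \<le> 3 * \<beta> * (\<tau>\<^sup>2 * a\<^sup>2 / \<sigma>)"
  proof -
    have "\<sigma> * a\<^sup>2 \<le> \<tau>\<^sup>2 * a\<^sup>2"
      using \<tau> mu by (intro mult_right_mono) (auto simp: \<sigma> power2_eq_square)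
    then show ?thesis
      using \<sigma>(2) beta by (intro mult_left_mono) (auto simp: field_simps)
  qed
  have t2: "2 * \<beta> * \<tau> * (a * e) \<le> \<beta> / \<mu> * \<sigma> * e\<^sup>2 + \<beta> * \<mu> * (\<tau>\<^sup>2 * a\<^sup>2 / \<sigma>)"
  proof -
    have "0 \<le> \<beta> / (\<mu> * \<sigma>) * (\<sigma> * e - \<mu> * \<tau> * a)\<^sup>2"
      using mu beta \<sigma>(2) by simp
    also have "\<dots> = \<beta> / \<mu> * \<sigma> * e\<^sup>2 + \<beta> * \<mu> * (\<tau>\<^sup>2 * a\<^sup>2 / \<sigma>) - 2 * \<beta> * \<tau> * (a * e)"
      using mu(1) \<sigma>(2) by (simp add: power2_diff power_mult_distrib power2_eq_square field_simps)
    finally show ?thesis by simp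
  qed
  have t3: "e * b \<le> \<beta> / \<mu> * \<sigma> * e\<^sup>2 + \<mu> / (4 * \<beta>) * (b\<^sup>2 / \<sigma>)"
  proof -
    have "0 \<le> 1 / (4 * \<beta> * \<mu> * \<sigma>) * (2 * \<beta> * \<sigma> * e - \<mu> * b)\<^sup>2"
      using mu beta \<sigma>(2) by simp
    also have "\<dots> = \<beta> / \<mu> * \<sigma> * e\<^sup>2 + \<mu> / (4 * \<beta>) * (b\<^sup>2 / \<sigma>) - e * b"
      using mu(1) beta(1) \<sigma>(2) by (simp add: power2_diff power_mult_distrib power2_eq_square field_simps)
    finally show ?thesis by simp
  qed
  have t4: "\<beta> * e\<^sup>2 \<le> \<beta> / \<mu> * \<sigma> * e\<^sup>2"
    using \<sigma>\<mu> mu beta by (intro mult_right_mono) (auto simp: field_simps)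
  define m where "m = 3 * \<beta> + \<beta> * \<mu> + \<mu> / (4 * \<beta>)"
  have m: "0 \<le> m" using mu beta by (simp add: m_def)
  have m1: "3 * \<beta> * (\<tau>\<^sup>2 * a\<^sup>2 / \<sigma>) + \<beta> * \<mu> * (\<tau>\<^sup>2 * a\<^sup>2 / \<sigma>) \<le> m * (\<tau>\<^sup>2 * a\<^sup>2 / \<sigma>)"
    unfolding distrib_right[symmetric] using mu beta \<sigma>(2) by (intro mult_right_mono) (auto simp: m_def)
  have m2: "\<mu> / (4 * \<beta>) * (b\<^sup>2 / \<sigma>) \<le> m * (b\<^sup>2 / \<sigma>)"
    using mu beta \<sigma>(2) by (intro mult_right_mono) (auto simp: m_def)
  have "\<tau>\<^sup>2 \<le> (2 * (\<tau> - \<mu>))\<^sup>2"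
    using \<tau> mu by (intro power_mono) auto
  then have "\<tau>\<^sup>2 * a\<^sup>2 + b\<^sup>2 \<le> (2 * (\<tau> - \<mu>))\<^sup>2 * a\<^sup>2 + 4 * b\<^sup>2"
    by (intro add_mono mult_right_mono) auto
  also have "\<dots> = 4 * ((\<tau> - \<mu>)\<^sup>2 * a\<^sup>2 + b\<^sup>2)"
    by (simp only: power_mult_distrib) simp
  also have "\<dots> \<le> 4 * (energy p k x z / \<delta>)"
  proof (rule mult_left_mono)
    show "(\<tau> - \<mu>)\<^sup>2 * a\<^sup>2 + b\<^sup>2 \<le> energy p k x z / \<delta>"
      using energy_lower_bound[OF p, of k x z] delta_pos
      unfolding pos_le_divide_eq[OF delta_pos] \<tau>_def a_def b_def by (simp only: mult.commute)
  qed simp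
  finally have "m / \<sigma> * (\<tau>\<^sup>2 * a\<^sup>2 + b\<^sup>2) \<le> m / \<sigma> * (4 * (energy p k x z / \<delta>))"
    using m \<sigma>(2) by (intro mult_left_mono) auto
  also have "\<dots> = K / s k * energy p k x z"
  proof -
    have "K = 4 * m / \<delta>"
      by (simp only: K_def m_def)
    then show ?thesis
      by (simp add: \<sigma>_def mult_ac)
  qed
  finally have m3: "m * (\<tau>\<^sup>2 * a\<^sup>2 / \<sigma>) + m * (b\<^sup>2 / \<sigma>) \<le> K / s k * energy p k x z"
    by (simp add: distrib_left)
  have "4 * \<beta> / \<mu> * \<sigma> * e\<^sup>2 = 4 * (\<beta> / \<mu> * \<sigma> * e\<^sup>2)" by simp
  then show ?thesis
    using energy_step_explicit[OF assms] t1 t2 t3 t4 m1 m2 m3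
    unfolding \<tau>_def[symmetric] \<sigma>_def[symmetric] a_def[symmetric] b_def[symmetric] e_def[symmetric]
    by (simp only: distrib_right mult_1)
qed

end

section \<open>Convergence along a path with summable perturbations\<close>

text \<open>
  This is the deterministic form of the Robbins-Siegmund lemma. Dividing by the products of the growth
  factors, which converge because \<open>a\<close> is summable, removes these factors; subtracting the partial
  sums of \<open>e\<close> and adding those of \<open>b\<close> then gives a decreasing sequence.
\<close>

lemma perturbed_decrease_convergent:
  fixes u a b e :: "nat \<Rightarrow> real"
  assumes step: "\<And>k. u (Suc k) + b k \<le> (1 + a k) * u k + e k"
    and nonneg: "\<And>k. 0 \<le> u k" "\<And>k. 0 \<le> a k" "\<And>k. 0 \<le> b k" "\<And>k. 0 \<le> e k"
    and sums: "summable a" "summable e"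
  shows "convergent u" "summable b"
proof -
  define P where "P k = (\<Prod>j<k. 1 + a j)" for k
  have P1: "1 \<le> P k" for k
    unfolding P_def by (intro prod_ge_1) (simp add: nonneg)
  have P_Suc: "P (Suc k) = P k * (1 + a k)" for k
    by (simp add: P_def)
  have P_le: "P k \<le> exp (suminf a)" for k
  proof -
    have "P k \<le> (\<Prod>j<k. exp (a j))"
      unfolding P_def by (intro prod_mono) (auto simp: nonneg exp_ge_add_one_self)
    also have "\<dots> = exp (\<Sum>j<k. a j)"
      by (simp add: exp_sum)
    also have "\<dots> \<le> exp (suminf a)"
      using sum_le_suminf[OF sums(1), of "{..<k}"] nonneg by simp
    finally show ?thesis .
  qed
  have "P k \<le> P (Suc k)" for k
    using P1[of k] nonneg(2)[of k] by (simp add: P_Suc)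
  then have "incseq P" by (rule incseq_SucI)
  then have convP: "convergent P"
    using P_le incseq_convergent[of P "exp (suminf a)"] unfolding convergent_def by blast
  define v where "v k = u k / P k" for k
  define b' where "b' k = b k / P (Suc k)" for k
  have v0: "0 \<le> v k" and b0: "0 \<le> b' k" for k
    using P1[of k] P1[of "Suc k"] nonneg by (simp_all add: v_def b'_def)
  have v_step: "v (Suc k) + b' k \<le> v k + e k" for k
  proof -
    have pos: "0 < P k" "0 < 1 + a k"
      using P1[of k] nonneg(2)[of k] by linarith+
    have "v (Suc k) + b' k = (u (Suc k) + b k) / P (Suc k)"
      by (simp add: v_def b'_def add_divide_distrib)
    also have "\<dots> \<le> ((1 + a k) * u k + e k) / P (Suc k)"
      using step[of k] P1[of "Suc k"] by (intro divide_right_mono) auto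
    also have "\<dots> = v k + e k / P (Suc k)"
      using pos by (simp add: v_def P_Suc add_divide_distrib)
    also have "e k / P (Suc k) \<le> e k / 1"
      using P1[of "Suc k"] nonneg(4)[of k] by (intro divide_left_mono) auto
    finally show ?thesis by simp
  qed
  define w where "w k = v k - (\<Sum>j<k. e j) + (\<Sum>j<k. b' j)" for k
  have w_dec: "w (Suc k) \<le> w k" for k
    using v_step[of k] by (simp add: w_def)
  then have dec: "decseq w" by (rule decseq_SucI)
  have sum_e: "(\<Sum>j<k. e j) \<le> suminf e" for k
    using sum_le_suminf[OF sums(2), of "{..<k}"] nonneg by simp
  have "- suminf e \<le> w k" for k
    using sum_e[of k] v0[of k] sum_nonneg[of "{..<k}" b'] b0 by (simp add: w_def)
  then have convw: "convergent w"
    using dec decseq_convergent[of w "- suminf e"] unfolding convergent_def by blast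
  have "(\<Sum>j<k. b' j) \<le> w 0 + suminf e" for k
    using decseqD[OF dec, of 0 k] sum_e[of k] v0[of k] by (simp add: w_def)
  then have sum_b': "summable b'"
    using b0 by (intro summableI_nonneg_bounded) auto
  have b_le: "b k \<le> exp (suminf a) * b' k" for k
    using mult_right_mono[OF P_le[of "Suc k"], of "b' k"] b0[of k] P1[of "Suc k"]
    by (simp add: b'_def)
  show "summable b"
    by (rule summable_comparison_test'[of "\<lambda>k. exp (suminf a) * b' k" 0])
      (use sum_b' b_le nonneg in \<open>auto intro: summable_mult\<close>)
  have "convergent (\<lambda>k. \<Sum>j<k. e j)" "convergent (\<lambda>k. \<Sum>j<k. b' j)"
    using sums(2) sum_b' by (simp_all add: summable_iff_convergent)
  then have "convergent (\<lambda>k. (w k + (\<Sum>j<k. e j) - (\<Sum>j<k. b' j)) * P k)"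
    using convw convP by (intro convergent_mult convergent_diff convergent_add) auto
  moreover have "(w k + (\<Sum>j<k. e j) - (\<Sum>j<k. b' j)) * P k = u k" for k
    using P1[of k] by (simp add: w_def v_def)
  ultimately show "convergent u" by simp
qed

text \<open>
  A positive limit would make the weights themselves summable.
\<close>

lemma limit_zero_of_weighted_summable:
  fixes u w :: "nat \<Rightarrow> real"
  assumes "convergent u" "\<And>k. 0 \<le> u k" "\<And>k. 0 \<le> w k"
    and "summable (\<lambda>k. w k * u k)" "\<not> summable w"
  shows "u \<longlonglongrightarrow> 0"
proof -
  obtain l where l: "u \<longlonglongrightarrow> l"
    using assms(1) by (auto simp: convergent_def)
  have "0 \<le> l"
    using l assms(2) by (intro LIMSEQ_le_const[OF l]) auto
  moreover have "\<not> 0 < l"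
  proof
    assume "0 < l"
    then have "eventually (\<lambda>k. l / 2 < u k) sequentially"
      by (intro order_tendstoD(1)[OF l]) simp
    then have "eventually (\<lambda>k. norm (w k) \<le> 2 / l * (w k * u k)) sequentially"
    proof eventually_elim
      case (elim k)
      then have "w k * (l / 2) \<le> w k * u k"
        using assms(3) by (intro mult_left_mono) auto
      then show ?case
        using \<open>0 < l\<close> assms(3)[of k] by (simp add: field_simps)
    qed
    then have "summable w"
      using assms(4) by (rule summable_comparison_test_ev[OF _ summable_mult])
    with assms(5) show False by simp
  qed
  ultimately show ?thesis using l by simp
qed

context fast_krasnoselskii_mann
begin

text \<open>
  The auxiliary points \<open>y k\<close> of the method are eliminated: they are determined by
  \<open>t k y k = (t k - 1) x k + z k\<close>.
\<close>

definition perturbed_iterates :: "(nat \<Rightarrow> 'a) \<Rightarrow> (nat \<Rightarrow> 'a) \<Rightarrow> (nat \<Rightarrow> 'a) \<Rightarrow> bool" where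
  "perturbed_iterates \<epsilon> x z \<longleftrightarrow>
     (\<forall>k. t k *\<^sub>R (x (Suc k) - x k) = z k - x k - (t k * \<eta> k) *\<^sub>R (G (x k) + \<epsilon> k) \<and>
          z (Suc k) = z k - (\<mu> / 2 * \<eta> k) *\<^sub>R (G (x k) + \<epsilon> k))"

lemma t_pos: "0 < t k"
  using t_ge_const[of k] mu by simp

lemma s_ge_t: "2 * \<mu> * t k \<le> s k"
proof -
  have "t k * (2 * \<mu>) \<le> t k * (t k - 1)"
    using t_ge_const[of k] t_pos[of k] by (intro mult_left_mono) auto
  then show ?thesis by (simp add: s_def mult_ac)
qed

lemma summable_inverse_s: "summable (\<lambda>k. K' / s k)"
proof -
  have "summable (\<lambda>k. 1 / (real k)\<^sup>2)"
    using inverse_power_summable[of 2, where 'a=real] by (simp add: inverse_eq_divide)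
  then have "summable (\<lambda>k. 1 / (real (Suc k))\<^sup>2)"
    by (subst summable_Suc_iff)
  then have "summable (\<lambda>k. 1 / \<mu>\<^sup>2 * (1 / (real (Suc k))\<^sup>2))"
    by (rule summable_mult)
  then have "summable (\<lambda>k. 1 / s k)"
  proof (rule summable_comparison_test'[of _ 0])
    fix k :: nat
    have "1 / s k \<le> 1 / (\<mu>\<^sup>2 * (real k + 1)\<^sup>2)"
      using s_ge[of k] s_pos[of k] mu by (intro divide_left_mono) auto
    then show "norm (1 / s k) \<le> 1 / \<mu>\<^sup>2 * (1 / (real (Suc k))\<^sup>2)"
      using s_pos[of k] by (simp add: add.commute)
  qed
  from summable_mult[OF this, of K'] show ?thesis by simp
qed

lemma not_summable_inverse_t: "\<not> summable (\<lambda>k. 1 / t k)"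
proof
  assume *: "summable (\<lambda>k. 1 / t k)"
  have r1: "1 \<le> r"
    using r mu by (smt (verit) divide_pos_pos)
  have "summable (\<lambda>k. \<mu> * r * (1 / t k))"
    using * by (rule summable_mult)
  then have "summable (\<lambda>k. 1 / real (Suc k))"
  proof (rule summable_comparison_test'[of _ 0])
    fix k :: nat
    have "real k + r \<le> r * (real k + 1)"
      using mult_right_mono[OF r1, of "real k"] by (simp add: algebra_simps)
    then have "t k \<le> \<mu> * r * real (Suc k)"
      using mu by (simp add: t_def add.commute)
    then show "norm (1 / real (Suc k)) \<le> \<mu> * r * (1 / t k)"
      using t_pos[of k] by (simp add: field_simps del: of_nat_Suc)
  qed
  then have "summable (\<lambda>k. inverse (real k))"
    using summable_Suc_iff[of "\<lambda>k. inverse (real k)"] by (simp add: inverse_eq_divide)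
  then show False
    using not_summable_harmonic[where 'a=real] by simp
qed

lemma continuous_G: "continuous_on X G"
proof -
  have pos: "0 < \<beta>bar" using beta beta_le by linarith
  have "norm (G a - G b) \<le> (1 / \<beta>bar) * norm (a - b)" for a b
  proof -
    have "\<beta>bar * (norm (G a - G b))\<^sup>2 \<le> (G a - G b) \<bullet> (a - b)"
      using co_coercive[of a b] Q_nonneg[of a b] by linarith
    also have "\<dots> \<le> norm (G a - G b) * norm (a - b)"
      by (rule norm_cauchy_schwarz)
    finally show ?thesis
      using pos by (cases "norm (G a - G b) = 0") (simp_all add: power2_eq_square field_simps)
  qed
  then have "(1 / \<beta>bar)-lipschitz_on X G"
    using pos by (intro lipschitz_onI) (auto simp: dist_norm)
  then show ?thesis by (rule lipschitz_on_continuous_on)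
qed

context
  fixes \<epsilon> x z :: "nat \<Rightarrow> 'a" and p0 :: 'a
  assumes iterates: "perturbed_iterates \<epsilon> x z"
    and noise: "summable (\<lambda>k. s k * (norm (\<epsilon> k))\<^sup>2)"
    and p0: "G p0 = 0"
begin

text \<open>
  \<open>W\<close> is the direction in which the method moves, and \<open>v\<close> the gap between its two sequences.
\<close>

definition "W k = G (x k) + \<epsilon> k"
definition "v k = z k - x k"

lemma x_step: "t k *\<^sub>R (x (Suc k) - x k) = z k - x k - (t k * \<eta> k) *\<^sub>R (G (x k) + \<epsilon> k)"
  and z_step: "z (Suc k) = z k - (\<mu> / 2 * \<eta> k) *\<^sub>R (G (x k) + \<epsilon> k)"
  using iterates by (simp_all add: perturbed_iterates_def)

lemma energy_convergent: "convergent (\<lambda>k. energy p0 k (x k) (z k))" (is "convergent ?V")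
    and summable_t_G: "summable (\<lambda>k. t k * (norm (G (x k)))\<^sup>2)"
proof -
  let ?b = "\<lambda>k. s k * Q (x (Suc k)) (x k) + \<beta> * (2 - 3 * \<mu>) * t k * (norm (G (x k)))\<^sup>2"
  let ?e = "\<lambda>k. 4 * \<beta> / \<mu> * s k * (norm (\<epsilon> k))\<^sup>2"
  have step: "?V (Suc k) + ?b k \<le> (1 + K / s k) * ?V k + ?e k" for k
    using energy_step[OF x_step[of k] z_step[of k] p0] by (simp only: add.assoc)
  have V0: "0 \<le> ?V k" for k
    by (rule energy_nonneg[OF p0])
  have b0: "0 \<le> s k * Q (x (Suc k)) (x k)" "0 \<le> \<beta> * (2 - 3 * \<mu>) * t k * (norm (G (x k)))\<^sup>2" for k
    using s_pos[of k] Q_nonneg t_pos[of k] mu beta by simp_all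
  have e0: "0 \<le> ?e k" for k
    using s_pos[of k] mu beta by simp
  have sum_e: "summable ?e"
    using summable_mult[OF noise, of "4 * \<beta> / \<mu>"] by (simp add: mult.assoc)
  have a0: "0 \<le> K / s k" for k
    using K_nonneg s_pos[of k] by simp
  note conv = perturbed_decrease_convergent[OF step V0 a0 _ e0 summable_inverse_s sum_e]
  show "convergent ?V"
    using conv(1) b0 by simp
  have "summable ?b"
    using conv(2) b0 by simp
  then have "summable (\<lambda>k. \<beta> * (2 - 3 * \<mu>) * t k * (norm (G (x k)))\<^sup>2)"
  proof (rule summable_comparison_test'[of _ 0])
    show "norm (\<beta> * (2 - 3 * \<mu>) * t k * (norm (G (x k)))\<^sup>2) \<le> ?b k" for k
      using b0[of k] unfolding real_norm_def by linarith
  qed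
  from summable_mult[OF this, of "1 / (\<beta> * (2 - 3 * \<mu>))"]
  show "summable (\<lambda>k. t k * (norm (G (x k)))\<^sup>2)"
    using mu beta by simp
qed

lemma summable_t_W: "summable (\<lambda>k. t k * (norm (W k))\<^sup>2)"
proof (rule summable_comparison_test'[of _ 0])
  show "summable (\<lambda>k. 2 * (t k * (norm (G (x k)))\<^sup>2) + 1 / \<mu> * (s k * (norm (\<epsilon> k))\<^sup>2))"
    by (intro summable_add summable_mult summable_t_G noise)
  fix k
  have "t k * (norm (W k))\<^sup>2 \<le> t k * (2 * (norm (G (x k)))\<^sup>2 + 2 * (norm (\<epsilon> k))\<^sup>2)"
    unfolding W_def using norm_add_sq_le t_pos[of k] by (intro mult_left_mono) auto
  moreover have "2 * t k * (norm (\<epsilon> k))\<^sup>2 \<le> (1 / \<mu> * s k) * (norm (\<epsilon> k))\<^sup>2"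
    using s_ge_t[of k] mu by (intro mult_right_mono) (auto simp: field_simps)
  ultimately show "norm (t k * (norm (W k))\<^sup>2)
      \<le> 2 * (t k * (norm (G (x k)))\<^sup>2) + 1 / \<mu> * (s k * (norm (\<epsilon> k))\<^sup>2)"
    using t_pos[of k] by (simp add: algebra_simps)
qed

text \<open>
  The step size \<open>\<eta> k\<close> is such that the direction enters the gap only with the coefficient
  \<open>s k (2 \<beta> - \<eta> k) / t k\<close>, which is bounded by \<open>2 \<beta>\<close>.
\<close>

lemma v_step: "v (Suc k) = (1 - 1 / t k) *\<^sub>R v k + (1 / t k) *\<^sub>R ((s k * (2 * \<beta> - \<eta> k)) *\<^sub>R W k)"
proof -
  have t0: "t k \<noteq> 0" using t_pos[of k] by simp
  have "t k *\<^sub>R v (Suc k) = t k *\<^sub>R z k - (t k * (\<mu> / 2 * \<eta> k)) *\<^sub>R W k - t k *\<^sub>R x k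
      - t k *\<^sub>R (x (Suc k) - x k)"
    by (simp add: v_def W_def z_step algebra_simps)
  also have "\<dots> = (t k - 1) *\<^sub>R v k + (t k * ((t k - \<mu> / 2) * \<eta> k - (t k - 1) * \<eta> k)) *\<^sub>R W k"
    unfolding x_step by (simp add: v_def W_def algebra_simps)
  also have "t k * ((t k - \<mu> / 2) * \<eta> k - (t k - 1) * \<eta> k) = s k * (2 * \<beta> - \<eta> k)"
    unfolding eta_eq by (simp add: s_def algebra_simps)
  finally have "(1 / t k) *\<^sub>R (t k *\<^sub>R v (Suc k))
      = (1 / t k) *\<^sub>R ((t k - 1) *\<^sub>R v k + (s k * (2 * \<beta> - \<eta> k)) *\<^sub>R W k)"
    by simp
  then show ?thesis
    using t0 by (simp add: scaleR_add_right diff_divide_distrib)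
qed

text \<open>
  By \<open>v_step\<close> the new gap is a convex combination, so its square loses the fraction \<open>1 / t k\<close> and
  gains at most \<open>4 \<beta>\<^sup>2 t k \<parallel>W k\<parallel>\<^sup>2\<close>, which is summable. As \<open>1 / t k\<close> is not summable, the limit is \<open>0\<close>.
\<close>

lemma v_limit: "(\<lambda>k. (norm (v k))\<^sup>2) \<longlonglongrightarrow> 0"
  and summable_v: "summable (\<lambda>k. (norm (v k))\<^sup>2 / t k)"
proof -
  have step: "(norm (v (Suc k)))\<^sup>2 + (norm (v k))\<^sup>2 / t k
      \<le> (1 + 0) * (norm (v k))\<^sup>2 + 4 * \<beta>\<^sup>2 * (t k * (norm (W k))\<^sup>2)" for k
  proof -
    define w \<alpha> where "w = (s k * (2 * \<beta> - \<eta> k)) *\<^sub>R W k" and "\<alpha> = 1 / t k"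
    have \<alpha>: "0 \<le> \<alpha>" "\<alpha> \<le> 1"
      using t_ge_const[of k] mu by (auto simp: \<alpha>_def)
    have "(norm ((1 - \<alpha>) *\<^sub>R v k + \<alpha> *\<^sub>R w))\<^sup>2 + \<alpha> * (1 - \<alpha>) * (norm (v k - w))\<^sup>2
        = (1 - \<alpha>) * (norm (v k))\<^sup>2 + \<alpha> * (norm w)\<^sup>2"
      by (simp only: power2_norm_eq_inner inner_add_left inner_add_right inner_diff_left
          inner_diff_right inner_scaleR_left inner_scaleR_right inner_commute[of w "v k"])
        (simp add: algebra_simps)
    moreover have "0 \<le> \<alpha> * (1 - \<alpha>) * (norm (v k - w))\<^sup>2"
      using \<alpha> by simp
    moreover have v_eq: "v (Suc k) = (1 - \<alpha>) *\<^sub>R v k + \<alpha> *\<^sub>R w"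
      unfolding \<alpha>_def w_def by (rule v_step)
    moreover have "(1 - \<alpha>) * (norm (v k))\<^sup>2 = (norm (v k))\<^sup>2 - \<alpha> * (norm (v k))\<^sup>2"
      by (simp add: left_diff_distrib)
    ultimately have 1: "(norm (v (Suc k)))\<^sup>2 + \<alpha> * (norm (v k))\<^sup>2 \<le> (norm (v k))\<^sup>2 + \<alpha> * (norm w)\<^sup>2"
      unfolding v_eq by linarith
    have "norm w \<le> (2 * \<beta> * t k) * norm (W k)"
      unfolding w_def norm_scaleR using s_eta_gap(2)[of k] s_pos[of k] eta_le[of k]
      by (intro mult_right_mono) auto
    then have "\<alpha> * (norm w)\<^sup>2 \<le> \<alpha> * ((2 * \<beta> * t k) * norm (W k))\<^sup>2"
      using \<alpha> by (intro mult_left_mono power_mono) auto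
    also have "\<dots> = 4 * \<beta>\<^sup>2 * (t k * (norm (W k))\<^sup>2)"
      using t_pos[of k] by (simp add: \<alpha>_def power_mult_distrib power2_eq_square)
    finally show ?thesis
      using 1 by (simp add: \<alpha>_def)
  qed
  have sum: "summable (\<lambda>k. 4 * \<beta>\<^sup>2 * (t k * (norm (W k))\<^sup>2))"
    by (intro summable_mult summable_t_W)
  have nonneg: "0 \<le> (norm (v k))\<^sup>2 / t k" "0 \<le> 4 * \<beta>\<^sup>2 * (t k * (norm (W k))\<^sup>2)" for k
    using t_pos[of k] by simp_all
  note conv = perturbed_decrease_convergent[where u = "\<lambda>k. (norm (v k))\<^sup>2" and a = "\<lambda>k. 0",
      OF step zero_le_power2 order_refl nonneg summable_zero sum]
  show s: "summable (\<lambda>k. (norm (v k))\<^sup>2 / t k)"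
    by (rule conv(2))
  show "(\<lambda>k. (norm (v k))\<^sup>2) \<longlonglongrightarrow> 0"
    by (rule limit_zero_of_weighted_summable[where w = "\<lambda>k. 1 / t k", OF conv(1)])
      (use s t_pos not_summable_inverse_t in \<open>auto simp: less_imp_le\<close>)
qed

text \<open>
  In \<open>\<langle>G x, z - p\<rangle> = \<langle>G x, x - p\<rangle> + \<langle>G x, v\<rangle>\<close> the first term has the right sign and the second one is
  summable by Young's inequality with weight \<open>t k\<close>. The zero \<open>p\<close> is arbitrary here, as Opial's
  argument requires.
\<close>

lemma z_distance_convergent:
  assumes p: "G p = 0"
  shows "convergent (\<lambda>k. (norm (z k - p))\<^sup>2)"
proof (rule perturbed_decrease_convergent(1)[where b = "\<lambda>k. 0" and a = "\<lambda>k. \<beta> / s k"])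
  let ?e = "\<lambda>k. \<beta> * (t k * (norm (G (x k)))\<^sup>2) + \<beta> * ((norm (v k))\<^sup>2 / t k)
      + \<beta> * (s k * (norm (\<epsilon> k))\<^sup>2) + \<beta>\<^sup>2 * (t k * (norm (W k))\<^sup>2)"
  show "summable ?e"
    by (intro summable_add summable_mult summable_t_G summable_v noise summable_t_W)
  show "summable (\<lambda>k. \<beta> / s k)"
    by (rule summable_inverse_s)
  show "0 \<le> ?e k" "0 \<le> \<beta> / s k" for k
    using t_pos[of k] s_pos[of k] beta by simp_all
  fix k
  define h where "h = \<mu> * \<eta> k"
  have h: "0 \<le> h" "h \<le> 2 * \<beta>"
    using mult_mono[of \<mu> 1 "\<eta> k" "2 * \<beta>"] eta_pos[of k] eta_le[of k] mu by (auto simp: h_def)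
  have young: "2 * (a * b) \<le> c * a\<^sup>2 + b\<^sup>2 / c" if "0 < c" for a b c :: real
  proof -
    have "0 \<le> (c * a - b)\<^sup>2 / c" using that by simp
    also have "\<dots> = c * a\<^sup>2 + b\<^sup>2 / c - 2 * (a * b)"
      using that by (simp add: power2_diff power_mult_distrib power2_eq_square field_simps)
    finally show ?thesis by simp
  qed
  have "W k \<bullet> (z k - p) = G (x k) \<bullet> (x k - p) + G (x k) \<bullet> v k + \<epsilon> k \<bullet> (z k - p)"
    by (simp add: W_def v_def inner_add_left inner_diff_right)
  moreover have "0 \<le> \<beta>bar * (norm (G (x k)))\<^sup>2"
    using beta beta_le by simp
  then have "0 \<le> G (x k) \<bullet> (x k - p)"
    using co_coercive_zero[OF p, of "x k"] by linarith
  ultimately have "- (W k \<bullet> (z k - p)) \<le> norm (G (x k)) * norm (v k) + norm (\<epsilon> k) * norm (z k - p)"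
    using Cauchy_Schwarz_ineq2[of "G (x k)" "v k"] Cauchy_Schwarz_ineq2[of "\<epsilon> k" "z k - p"]
    by linarith
  then have "h * - (W k \<bullet> (z k - p))
      \<le> h * (norm (G (x k)) * norm (v k) + norm (\<epsilon> k) * norm (z k - p))"
    using h by (intro mult_left_mono) auto
  also have "\<dots> \<le> 2 * \<beta> * (norm (G (x k)) * norm (v k) + norm (\<epsilon> k) * norm (z k - p))"
    using h by (intro mult_right_mono) auto
  also have "\<dots> = \<beta> * (2 * (norm (G (x k)) * norm (v k))) + \<beta> * (2 * (norm (\<epsilon> k) * norm (z k - p)))"
    by (simp add: algebra_simps)
  also have "\<dots> \<le> \<beta> * (t k * (norm (G (x k)))\<^sup>2 + (norm (v k))\<^sup>2 / t k)
      + \<beta> * (s k * (norm (\<epsilon> k))\<^sup>2 + (norm (z k - p))\<^sup>2 / s k)"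
    using beta t_pos[of k] s_pos[of k] by (intro add_mono mult_left_mono young) auto
  finally have cross: "- (h * (W k \<bullet> (z k - p))) \<le> \<beta> * (t k * (norm (G (x k)))\<^sup>2 + (norm (v k))\<^sup>2 / t k)
      + \<beta> * (s k * (norm (\<epsilon> k))\<^sup>2 + (norm (z k - p))\<^sup>2 / s k)"
    by simp
  have "z (Suc k) - p = (z k - p) - (h / 2) *\<^sub>R W k"
    by (simp add: z_step W_def h_def)
  then have expand: "(norm (z (Suc k) - p))\<^sup>2 = (norm (z k - p))\<^sup>2 - h * (W k \<bullet> (z k - p)) + (h / 2)\<^sup>2 * (norm (W k))\<^sup>2"
    by (simp only: power2_norm_eq_inner inner_diff_left inner_diff_right inner_scaleR_left
        inner_scaleR_right inner_commute[of "z k" "W k"] inner_commute[of p "W k"])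
      (simp add: power2_eq_square algebra_simps)
  have "(h / 2)\<^sup>2 * (norm (W k))\<^sup>2 \<le> \<beta>\<^sup>2 * (t k * (norm (W k))\<^sup>2)"
  proof (intro mult_mono power_mono)
    show "(norm (W k))\<^sup>2 \<le> t k * (norm (W k))\<^sup>2"
      using mult_right_mono[of 1 "t k" "(norm (W k))\<^sup>2"] t_ge_const[of k] mu by simp
  qed (use h in auto)
  then show "(norm (z (Suc k) - p))\<^sup>2 + 0 \<le> (1 + \<beta> / s k) * (norm (z k - p))\<^sup>2 + ?e k"
    using expand cross by (simp add: algebra_simps)
qed simp_all

text \<open>
  In the energy the mixed term tends to \<open>0\<close> with the gap \<open>v\<close>, and the distance term converges, so
  \<open>q k \<parallel>G (x k)\<parallel>\<^sup>2\<close> converges too. Its limit is \<open>0\<close> because \<open>t k \<parallel>G (x k)\<parallel>\<^sup>2\<close> is summable while \<open>1 / t k\<close>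
  is not.
\<close>

lemma G_limit: "(\<lambda>k. (real k)\<^sup>2 * (norm (G (x k)))\<^sup>2) \<longlonglongrightarrow> 0"
proof -
  let ?V = "\<lambda>k. energy p0 k (x k) (z k)"
  define q where "q k = (t k - \<mu>) * (t k - \<mu> - 1)" for k
  have q_ge: "\<mu>\<^sup>2 * (real k)\<^sup>2 \<le> q k" for k
  proof -
    have "(\<mu> * real k) * (\<mu> * real k) \<le> (t k - \<mu>) * (t k - \<mu> - 1)"
      using t_ge[of k] t_ge_const[of k] mu by (intro mult_mono) (auto simp: algebra_simps)
    then show ?thesis by (simp add: q_def power2_eq_square mult_ac)
  qed
  obtain B where B: "\<And>k. norm (?V k) \<le> B"
    using convergent_imp_Bseq[OF energy_convergent] by (auto simp: Bseq_def)
  have "norm ((t k - \<mu>) * (G (x k) \<bullet> v k)) \<le> sqrt (B / \<delta>) * norm (v k)" for k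
  proof -
    have "\<delta> * ((t k - \<mu>)\<^sup>2 * (norm (G (x k)))\<^sup>2) \<le> \<delta> * ((t k - \<mu>)\<^sup>2 * (norm (G (x k)))\<^sup>2 + (norm (z k - p0))\<^sup>2)"
      using delta_pos by (intro mult_left_mono) auto
    also have "\<dots> \<le> B"
      using energy_lower_bound[OF p0, of k "x k" "z k"] B[of k] by simp
    finally have "((t k - \<mu>) * norm (G (x k)))\<^sup>2 \<le> B / \<delta>"
      using delta_pos by (simp add: power_mult_distrib pos_le_divide_eq mult.commute)
    then have "(t k - \<mu>) * norm (G (x k)) \<le> sqrt (B / \<delta>)"
      by (rule real_le_rsqrt)
    then have "(t k - \<mu>) * norm (G (x k)) * norm (v k) \<le> sqrt (B / \<delta>) * norm (v k)"
      by (rule mult_right_mono) simp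
    moreover have "norm ((t k - \<mu>) * (G (x k) \<bullet> v k)) \<le> (t k - \<mu>) * (norm (G (x k)) * norm (v k))"
      using t_ge_const[of k] mu Cauchy_Schwarz_ineq2[of "G (x k)" "v k"]
      by (auto simp: abs_mult intro!: mult_mono)
    ultimately show ?thesis by simp
  qed
  moreover have v0: "(\<lambda>k. norm (v k)) \<longlonglongrightarrow> 0"
    using tendsto_real_sqrt[OF v_limit] by simp
  ultimately have "(\<lambda>k. (t k - \<mu>) * (G (x k) \<bullet> v k)) \<longlonglongrightarrow> 0"
    by (intro Lim_null_comparison[OF always_eventually tendsto_mult_right_zero[OF v0]]) blast
  then have c1: "convergent (\<lambda>k. (t k - \<mu>) * (G (x k) \<bullet> v k))"
    by (auto simp: convergent_def)
  have "decseq c"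
    using c_mono by (rule decseq_SucI)
  moreover have "0 \<le> c k" for k
    using mu eta_pos[of k] by (simp add: c_def)
  ultimately have c2: "convergent c"
    using decseq_convergent[of c 0] unfolding convergent_def by blast
  have "convergent (\<lambda>k. (1 / \<beta>) * (?V k + (t k - \<mu>) * (G (x k) \<bullet> v k) - c k * (norm (z k - p0))\<^sup>2))"
    by (intro convergent_mult convergent_const convergent_diff convergent_add energy_convergent c1 c2
        z_distance_convergent p0)
  moreover have "(1 / \<beta>) * (?V k + (t k - \<mu>) * (G (x k) \<bullet> v k) - c k * (norm (z k - p0))\<^sup>2)
      = q k * (norm (G (x k)))\<^sup>2" for k
    using beta(1) by (simp add: energy_def q_def v_def inner_diff_right algebra_simps)
  ultimately have conv: "convergent (\<lambda>k. q k * (norm (G (x k)))\<^sup>2)" by simp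
  have q0: "0 \<le> q k" for k
    using q_ge[of k] by (smt (verit) zero_le_mult_iff zero_le_power2)
  have "(\<lambda>k. q k * (norm (G (x k)))\<^sup>2) \<longlonglongrightarrow> 0"
  proof (rule limit_zero_of_weighted_summable[OF conv])
    show "summable (\<lambda>k. 1 / t k * (q k * (norm (G (x k)))\<^sup>2))"
    proof (rule summable_comparison_test'[OF summable_t_G, of 0])
      fix k
      have "q k \<le> t k * t k"
        unfolding q_def using t_ge_const[of k] mu by (intro mult_mono) auto
      then have "1 / t k * q k \<le> t k"
        using t_pos[of k] by (simp add: field_simps)
      from mult_right_mono[OF this, of "(norm (G (x k)))\<^sup>2"]
      show "norm (1 / t k * (q k * (norm (G (x k)))\<^sup>2)) \<le> t k * (norm (G (x k)))\<^sup>2"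
        using t_pos[of k] q0[of k] by simp
    qed
  qed (use q0 t_pos not_summable_inverse_t in \<open>auto simp: less_imp_le\<close>)
  from tendsto_mult_right_zero[OF this, of "1 / \<mu>\<^sup>2"]
  show ?thesis
  proof (rule Lim_null_comparison[OF always_eventually, rotated], intro allI)
    fix k
    have "\<mu>\<^sup>2 * (real k)\<^sup>2 * (norm (G (x k)))\<^sup>2 \<le> q k * (norm (G (x k)))\<^sup>2"
      by (rule mult_right_mono[OF q_ge]) simp
    then show "norm ((real k)\<^sup>2 * (norm (G (x k)))\<^sup>2) \<le> 1 / \<mu>\<^sup>2 * (q k * (norm (G (x k)))\<^sup>2)"
      using mu by (simp add: field_simps)
  qed
qed

lemma k_le_t: "real k + 1 \<le> t k / \<mu>"
  using t_ge[of k] mu by (simp add: field_simps)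

lemma summable_G: "summable (\<lambda>k. (real k + 1) * (norm (G (x k)))\<^sup>2)"
proof (rule summable_comparison_test'[OF summable_mult[OF summable_t_G, of "1 / \<mu>"], of 0])
  fix k
  show "norm ((real k + 1) * (norm (G (x k)))\<^sup>2) \<le> 1 / \<mu> * (t k * (norm (G (x k)))\<^sup>2)"
    using mult_right_mono[OF k_le_t[of k], of "(norm (G (x k)))\<^sup>2"] by simp
qed

lemma displacement_le: "(norm (x (Suc k) - x k))\<^sup>2 \<le> 2 * (norm (v k))\<^sup>2 / (t k)\<^sup>2 + 8 * \<beta>\<^sup>2 * (norm (W k))\<^sup>2"
proof -
  have "(1 / t k) *\<^sub>R (t k *\<^sub>R (x (Suc k) - x k)) = (1 / t k) *\<^sub>R (v k - (t k * \<eta> k) *\<^sub>R W k)"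
    unfolding x_step by (simp add: v_def W_def)
  then have eq: "x (Suc k) - x k = (1 / t k) *\<^sub>R v k + (- \<eta> k) *\<^sub>R W k"
    using t_pos[of k] by (simp add: scaleR_diff_right)
  have "(norm (x (Suc k) - x k))\<^sup>2 \<le> 2 * (norm ((1 / t k) *\<^sub>R v k))\<^sup>2 + 2 * (norm ((- \<eta> k) *\<^sub>R W k))\<^sup>2"
    unfolding eq by (rule norm_add_sq_le)
  moreover have "(\<eta> k)\<^sup>2 * (norm (W k))\<^sup>2 \<le> (2 * \<beta>)\<^sup>2 * (norm (W k))\<^sup>2"
    using eta_pos[of k] eta_le[of k] by (intro mult_right_mono power_mono) auto
  ultimately show ?thesis
    by (simp add: power_mult_distrib power_divide)
qed

lemma summable_displacement: "summable (\<lambda>k. (real k + 1) * (norm (x (Suc k) - x k))\<^sup>2)"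
proof (rule summable_comparison_test'[of _ 0])
  show "summable (\<lambda>k. 1 / \<mu> * (2 * ((norm (v k))\<^sup>2 / t k) + 8 * \<beta>\<^sup>2 * (t k * (norm (W k))\<^sup>2)))"
    by (intro summable_mult summable_add summable_v summable_t_W)
  fix k
  have "(real k + 1) * (norm (x (Suc k) - x k))\<^sup>2
      \<le> t k / \<mu> * (2 * (norm (v k))\<^sup>2 / (t k)\<^sup>2 + 8 * \<beta>\<^sup>2 * (norm (W k))\<^sup>2)"
    using t_pos[of k] mu by (intro mult_mono k_le_t displacement_le) auto
  also have "\<dots> = 1 / \<mu> * (2 * ((norm (v k))\<^sup>2 / t k) + 8 * \<beta>\<^sup>2 * (t k * (norm (W k))\<^sup>2))"
    using t_pos[of k] mu(1) by (simp add: power2_eq_square field_simps)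
  finally show "norm ((real k + 1) * (norm (x (Suc k) - x k))\<^sup>2)
      \<le> 1 / \<mu> * (2 * ((norm (v k))\<^sup>2 / t k) + 8 * \<beta>\<^sup>2 * (t k * (norm (W k))\<^sup>2))"
    by simp
qed

lemma displacement_limit: "(\<lambda>k. (real k)\<^sup>2 * (norm (x (Suc k) - x k))\<^sup>2) \<longlonglongrightarrow> 0"
proof -
  have "(\<lambda>k. 2 / \<mu>\<^sup>2 * (norm (v k))\<^sup>2 + 8 * \<beta>\<^sup>2 * (2 * ((real k)\<^sup>2 * (norm (G (x k)))\<^sup>2)
      + 2 * (1 / \<mu>\<^sup>2 * (s k * (norm (\<epsilon> k))\<^sup>2)))) \<longlonglongrightarrow> 0"
    by (intro tendsto_add_zero tendsto_mult_right_zero v_limit G_limit summable_LIMSEQ_zero[OF noise])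
  then show ?thesis
  proof (rule Lim_null_comparison[OF always_eventually, rotated], intro allI)
    fix k
    have k: "real k \<le> t k / \<mu>" using k_le_t[of k] by simp
    have "(real k)\<^sup>2 * (norm (x (Suc k) - x k))\<^sup>2
        \<le> (real k)\<^sup>2 * (2 * (norm (v k))\<^sup>2 / (t k)\<^sup>2 + 8 * \<beta>\<^sup>2 * (norm (W k))\<^sup>2)"
      by (intro mult_left_mono displacement_le) simp
    also have "\<dots> = (real k)\<^sup>2 * (2 * (norm (v k))\<^sup>2 / (t k)\<^sup>2) + 8 * \<beta>\<^sup>2 * ((real k)\<^sup>2 * (norm (W k))\<^sup>2)"
      by (simp add: algebra_simps)
    also have "(real k)\<^sup>2 * (2 * (norm (v k))\<^sup>2 / (t k)\<^sup>2) \<le> (t k / \<mu>)\<^sup>2 * (2 * (norm (v k))\<^sup>2 / (t k)\<^sup>2)"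
      using k by (intro mult_right_mono power_mono) auto
    also have "\<dots> = 2 / \<mu>\<^sup>2 * (norm (v k))\<^sup>2"
      using t_pos[of k] by (simp add: power_divide)
    also have "(real k)\<^sup>2 * (norm (W k))\<^sup>2 \<le> (real k)\<^sup>2 * (2 * (norm (G (x k)))\<^sup>2 + 2 * (norm (\<epsilon> k))\<^sup>2)"
      unfolding W_def by (intro mult_left_mono norm_add_sq_le) simp
    also have "\<dots> = 2 * ((real k)\<^sup>2 * (norm (G (x k)))\<^sup>2) + 2 * ((real k)\<^sup>2 * (norm (\<epsilon> k))\<^sup>2)"
      by (simp add: algebra_simps)
    also have "(real k)\<^sup>2 * (norm (\<epsilon> k))\<^sup>2 \<le> 1 / \<mu>\<^sup>2 * (s k * (norm (\<epsilon> k))\<^sup>2)"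
    proof -
      have "\<mu>\<^sup>2 * (real k)\<^sup>2 \<le> \<mu>\<^sup>2 * (real k + 1)\<^sup>2"
        by (intro mult_left_mono power_mono) auto
      from mult_right_mono[OF order_trans[OF this s_ge], of "(norm (\<epsilon> k))\<^sup>2"]
      show ?thesis using mu by (simp add: field_simps)
    qed
    finally show "norm ((real k)\<^sup>2 * (norm (x (Suc k) - x k))\<^sup>2) \<le> 2 / \<mu>\<^sup>2 * (norm (v k))\<^sup>2
       + 8 * \<beta>\<^sup>2 * (2 * ((real k)\<^sup>2 * (norm (G (x k)))\<^sup>2) + 2 * (1 / \<mu>\<^sup>2 * (s k * (norm (\<epsilon> k))\<^sup>2)))"
      by (simp add: mult_left_mono)
  qed
qed

text \<open>
  Opial's argument: \<open>z\<close> has a cluster point \<open>q\<close>, which \<open>x\<close> shares since the gap vanishes, so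
  \<open>G q = 0\<close>. Hence \<open>\<parallel>z k - q\<parallel>\<close> converges, and it tends to \<open>0\<close> along a subsequence.
\<close>

lemma iterates_converge: "\<exists>q. G q = 0 \<and> x \<longlonglongrightarrow> q \<and> z \<longlonglongrightarrow> q"
proof -
  have v0: "v \<longlonglongrightarrow> 0"
    using tendsto_real_sqrt[OF v_limit] by (simp add: tendsto_norm_zero_iff)
  obtain B where B: "\<And>k. norm ((norm (z k - p0))\<^sup>2) \<le> B"
    using convergent_imp_Bseq[OF z_distance_convergent[OF p0]] by (auto simp: Bseq_def)
  have "norm (z k) \<le> norm p0 + sqrt B" for k
  proof -
    have "norm (z k - p0) \<le> sqrt B"
      using B[of k] by (intro real_le_rsqrt) simp
    then show ?thesis
      using norm_triangle_sub[of "z k" p0] by linarith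
  qed
  then have "bounded (range z)"
    by (auto simp: bounded_iff)
  then obtain q h where h: "strict_mono h" "(z \<circ> h) \<longlonglongrightarrow> q"
    using bounded_imp_convergent_subsequence by blast
  have "(\<lambda>k. (z \<circ> h) k - (v \<circ> h) k) \<longlonglongrightarrow> q - 0"
    using h(2) LIMSEQ_subseq_LIMSEQ[OF v0 h(1)] by (rule tendsto_diff)
  then have xh: "(\<lambda>k. x (h k)) \<longlonglongrightarrow> q"
    by (simp add: v_def)
  have "isCont G q"
    using continuous_G[of UNIV] by (simp add: continuous_on_eq_continuous_at)
  then have "(\<lambda>k. G (x (h k))) \<longlonglongrightarrow> G q"
    using xh by (rule isCont_tendsto_compose)
  moreover have "(\<lambda>k. G (x k)) \<longlonglongrightarrow> 0"
  proof -
    have "(\<lambda>k. (norm (G (x k)))\<^sup>2) \<longlonglongrightarrow> 0"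
    proof (rule Lim_null_comparison[OF always_eventually summable_LIMSEQ_zero[OF summable_G]], intro allI)
      fix k
      show "norm ((norm (G (x k)))\<^sup>2) \<le> (real k + 1) * (norm (G (x k)))\<^sup>2"
        using mult_right_mono[of 1 "real k + 1" "(norm (G (x k)))\<^sup>2"] by simp
    qed
    from tendsto_real_sqrt[OF this] show ?thesis
      by (simp add: tendsto_norm_zero_iff)
  qed
  then have "(\<lambda>k. G (x (h k))) \<longlonglongrightarrow> 0"
    using LIMSEQ_subseq_LIMSEQ[OF _ h(1)] by (fastforce simp: o_def)
  ultimately have q: "G q = 0"
    by (rule LIMSEQ_unique)
  obtain l where l: "(\<lambda>k. (norm (z k - q))\<^sup>2) \<longlonglongrightarrow> l"
    using z_distance_convergent[OF q] by (auto simp: convergent_def)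
  have "(\<lambda>k. (norm ((z \<circ> h) k - q))\<^sup>2) \<longlonglongrightarrow> (norm (q - q))\<^sup>2"
    using h(2) by (intro tendsto_intros)
  moreover have "(\<lambda>k. (norm ((z \<circ> h) k - q))\<^sup>2) \<longlonglongrightarrow> l"
    using LIMSEQ_subseq_LIMSEQ[OF l h(1)] by (simp add: o_def)
  ultimately have "(norm (q - q))\<^sup>2 = l"
    by (rule LIMSEQ_unique)
  then have "l = 0" by simp
  with l have "(\<lambda>k. norm (z k - q)) \<longlonglongrightarrow> 0"
    using tendsto_real_sqrt[OF l] by simp
  then have zq: "z \<longlonglongrightarrow> q"
    by (simp add: tendsto_norm_zero_iff LIM_zero_iff)
  have "(\<lambda>k. z k - v k) \<longlonglongrightarrow> q - 0"
    using zq v0 by (rule tendsto_diff)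
  then have "x \<longlonglongrightarrow> q"
    by (simp add: v_def)
  with q zq show ?thesis by blast
qed

end

end

section \<open>Almost sure summability of the noise\<close>

lemma ennreal_add_mult_le_iff:
  assumes "0 \<le> a" "0 \<le> b" "0 \<le> c" "0 \<le> a'" "0 \<le> b'" "0 \<le> c'" "0 \<le> d'"
  shows "ennreal a + ennreal b * ennreal c \<le> ennreal a' * ennreal b' + ennreal c' * ennreal d'
    \<longleftrightarrow> a + b * c \<le> a' * b' + c' * d'"
  using assms by (simp flip: ennreal_mult ennreal_plus)

context fast_krasnoselskii_mann
begin

lemma continuous_energy: "continuous_on UNIV (\<lambda>w. energy p k (fst w) (snd w))"
  unfolding energy_def
  by (intro continuous_intros continuous_on_compose2[OF continuous_G[of UNIV]]) auto

text \<open>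
  Here \<open>D k\<close> stands for \<open>E[\<Delta> k]\<close>, and \<open>e k\<close> for the squared error of the estimator. The sum
  \<open>E[V k] + \<Gamma> k (t k - \<mu>) (t k - \<mu> - 1) D k\<close> is again a perturbed decreasing sequence: the terms \<open>s k E[Q]\<close>
  of the energy inequality and of the variance recursion cancel, and the noise coefficient
  \<open>4 \<beta> / \<mu>\<close> is outweighed by \<open>5 \<beta> / \<mu>\<close>. All expectations are first taken in \<open>ennreal\<close>; their
  finiteness follows by the same two inequalities, by induction on \<open>k\<close>.
\<close>

lemma AE_summable_noise:
  fixes M :: "'w measure" and x z \<epsilon> :: "nat \<Rightarrow> 'w \<Rightarrow> 'a" and e :: "nat \<Rightarrow> 'w \<Rightarrow> real"
    and D :: "nat \<Rightarrow> ennreal" and \<kappa> \<theta> \<Gamma> \<xi> :: "nat \<Rightarrow> real"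
  assumes p: "G p = 0"
    and prob: "prob_space M"
    and x0: "\<And>\<omega>. \<omega> \<in> space M \<Longrightarrow> x 0 \<omega> = x0" "\<And>\<omega>. \<omega> \<in> space M \<Longrightarrow> z 0 \<omega> = x0"
    and iterates: "\<And>\<omega>. \<omega> \<in> space M \<Longrightarrow>
        perturbed_iterates (\<lambda>k. \<epsilon> k \<omega>) (\<lambda>k. x k \<omega>) (\<lambda>k. z k \<omega>)"
    and meas: "\<And>k. x k \<in> borel_measurable M" "\<And>k. z k \<in> borel_measurable M"
      "\<And>k. e k \<in> borel_measurable M"
      "\<And>k. (\<lambda>\<omega>. Q (x (Suc k) \<omega>) (x k \<omega>)) \<in> borel_measurable M"
    and noise: "\<And>k \<omega>. \<omega> \<in> space M \<Longrightarrow> (norm (\<epsilon> k \<omega>))\<^sup>2 \<le> e k \<omega>"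
      "\<And>k. (\<integral>\<^sup>+\<omega>. ennreal (e k \<omega>) \<partial>M) \<le> D k"
    and D0: "D 0 < \<infinity>"
    and D_Suc: "\<And>k. D (Suc k) \<le> ennreal (1 - \<kappa> k) * D k
        + ennreal (\<theta> k) * (\<integral>\<^sup>+\<omega>. ennreal (Q (x (Suc k) \<omega>) (x k \<omega>)) \<partial>M) + ennreal (\<xi> k)"
    and pars: "\<And>k. \<kappa> k \<le> 1" "\<And>k. 0 \<le> \<theta> k" "\<And>k. 0 \<le> \<xi> k" "\<And>k. 0 \<le> \<Gamma> k"
      "\<And>k. \<Gamma> (Suc k) * \<theta> k \<le> 1"
      "\<And>k. \<Gamma> (Suc k) * s k * (1 - \<kappa> k)
         \<le> \<Gamma> k * ((t k - \<mu>) * (t k - \<mu> - 1)) - 5 * \<beta> / \<mu> * s k"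
      "summable (\<lambda>k. \<Gamma> (Suc k) * s k * \<xi> k)"
  shows "AE \<omega> in M. summable (\<lambda>k. s k * e k \<omega>)"
proof -
  interpret prob_space M by (rule prob)
  define V q where "V k \<omega> = energy p k (x k \<omega>) (z k \<omega>)" and "q k \<omega> = Q (x (Suc k) \<omega>) (x k \<omega>)" for k \<omega>
  define EV Eq where "EV k = (\<integral>\<^sup>+\<omega>. ennreal (V k \<omega>) \<partial>M)" and "Eq k = (\<integral>\<^sup>+\<omega>. ennreal (q k \<omega>) \<partial>M)" for k
  have [measurable]: "x k \<in> borel_measurable M" "z k \<in> borel_measurable M"
    "e k \<in> borel_measurable M" "q k \<in> borel_measurable M" for k
    using meas unfolding q_def by auto
  have [measurable]: "V k \<in> borel_measurable M" for k
  proof -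
    have "(\<lambda>\<omega>. (\<lambda>w. energy p k (fst w) (snd w)) (x k \<omega>, z k \<omega>)) \<in> borel_measurable M"
      by (rule borel_measurable_continuous_on[OF continuous_energy]) measurable
    then show ?thesis
      unfolding V_def by simp
  qed
  have V0: "0 \<le> V k \<omega>" and q0: "0 \<le> q k \<omega>" for k \<omega>
    unfolding V_def q_def using energy_nonneg[OF p] Q_nonneg by auto
  have Ks: "0 \<le> 1 + K / s k" for k
    using K_nonneg s_pos[of k] by (simp add: add_nonneg_nonneg)
  have C: "0 \<le> 4 * \<beta> / \<mu> * s k" for k
    using mu beta s_pos[of k] by simp
  have step: "EV (Suc k) + ennreal (s k) * Eq k
      \<le> ennreal (1 + K / s k) * EV k + ennreal (4 * \<beta> / \<mu> * s k) * D k" for k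
  proof -
    have "EV (Suc k) + ennreal (s k) * Eq k
        = (\<integral>\<^sup>+\<omega>. ennreal (V (Suc k) \<omega>) + ennreal (s k) * ennreal (q k \<omega>) \<partial>M)"
      by (simp add: EV_def Eq_def nn_integral_add nn_integral_cmult)
    also have "\<dots> \<le> (\<integral>\<^sup>+\<omega>. ennreal (1 + K / s k) * ennreal (V k \<omega>)
        + ennreal (4 * \<beta> / \<mu> * s k) * ennreal (e k \<omega>) \<partial>M)"
    proof (rule nn_integral_mono)
      fix \<omega> assume \<omega>: "\<omega> \<in> space M"
      have it: "t k *\<^sub>R (x (Suc k) \<omega> - x k \<omega>) = z k \<omega> - x k \<omega> - (t k * \<eta> k) *\<^sub>R (G (x k \<omega>) + \<epsilon> k \<omega>)"
        "z (Suc k) \<omega> = z k \<omega> - (\<mu> / 2 * \<eta> k) *\<^sub>R (G (x k \<omega>) + \<epsilon> k \<omega>)"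
        using iterates[OF \<omega>] by (simp_all add: perturbed_iterates_def)
      have "0 \<le> \<beta> * (2 - 3 * \<mu>) * t k * (norm (G (x k \<omega>)))\<^sup>2"
        using beta mu t_pos[of k] by simp
      moreover have "4 * \<beta> / \<mu> * s k * (norm (\<epsilon> k \<omega>))\<^sup>2 \<le> 4 * \<beta> / \<mu> * s k * e k \<omega>"
        using noise(1)[OF \<omega>] C by (rule mult_left_mono)
      ultimately have "V (Suc k) \<omega> + s k * q k \<omega> \<le> (1 + K / s k) * V k \<omega> + 4 * \<beta> / \<mu> * s k * e k \<omega>"
        using energy_step[OF it p] unfolding V_def q_def by linarith
      moreover have e0: "0 \<le> e k \<omega>"
        using noise(1)[OF \<omega>, of k] zero_le_power2 order_trans by blast
      ultimately show "ennreal (V (Suc k) \<omega>) + ennreal (s k) * ennreal (q k \<omega>)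
          \<le> ennreal (1 + K / s k) * ennreal (V k \<omega>) + ennreal (4 * \<beta> / \<mu> * s k) * ennreal (e k \<omega>)"
        using V0 q0 Ks[of k] C[of k] s_pos[of k] by (subst ennreal_add_mult_le_iff) auto
    qed
    also have "\<dots> = ennreal (1 + K / s k) * EV k
        + ennreal (4 * \<beta> / \<mu> * s k) * (\<integral>\<^sup>+\<omega>. ennreal (e k \<omega>) \<partial>M)"
      by (simp add: EV_def nn_integral_add nn_integral_cmult)
    also have "\<dots> \<le> ennreal (1 + K / s k) * EV k + ennreal (4 * \<beta> / \<mu> * s k) * D k"
      by (intro add_left_mono mult_left_mono noise(2)) simp
    finally show ?thesis .
  qed
  have fin_step: "EV (Suc k) < \<infinity> \<and> Eq k < \<infinity> \<and> D (Suc k) < \<infinity>" if "EV k < \<infinity>" "D k < \<infinity>" for k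
  proof -
    have "ennreal (1 + K / s k) * EV k + ennreal (4 * \<beta> / \<mu> * s k) * D k < \<infinity>"
      using that by (simp add: ennreal_mult_less_top)
    then have "EV (Suc k) + ennreal (s k) * Eq k < \<infinity>"
      using step[of k] by (rule le_less_trans[rotated])
    then have 1: "EV (Suc k) < \<infinity>" "ennreal (s k) * Eq k < \<infinity>"
      by (auto simp: less_top)
    then have 2: "Eq k < \<infinity>"
      using s_pos[of k] by (auto simp: ennreal_mult_less_top)
    have "ennreal (1 - \<kappa> k) * D k + ennreal (\<theta> k) * Eq k + ennreal (\<xi> k) < \<infinity>"
      using that 2 by (simp add: ennreal_mult_less_top)
    then have "D (Suc k) < \<infinity>"
      using D_Suc[of k] unfolding Eq_def q_def by (rule le_less_trans[rotated])
    with 1 2 show ?thesis by simp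
  qed
  have EV0: "EV 0 < \<infinity>"
  proof -
    have "EV 0 = (\<integral>\<^sup>+\<omega>. ennreal (energy p 0 x0 x0) \<partial>M)"
      unfolding EV_def V_def using x0 by (intro nn_integral_cong) simp
    then show ?thesis
      by (simp add: emeasure_space_1)
  qed
  have fin: "EV k < \<infinity> \<and> D k < \<infinity>" for k
    by (induction k) (use EV0 D0 fin_step in auto)
  define v d r where "v k = enn2real (EV k)" and "d k = enn2real (D k)" and "r k = enn2real (Eq k)" for k
  have real: "EV k = ennreal (v k)" "D k = ennreal (d k)" "Eq k = ennreal (r k)" for k
    using fin[of k] fin_step[of k] by (auto simp: v_def d_def r_def less_top)
  have nonneg: "0 \<le> v k" "0 \<le> d k" "0 \<le> r k" for k
    by (simp_all add: v_def d_def r_def)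
  have step_r: "v (Suc k) + s k * r k \<le> (1 + K / s k) * v k + 4 * \<beta> / \<mu> * s k * d k" for k
    using step[of k] unfolding real
    by (subst (asm) ennreal_add_mult_le_iff) (use nonneg Ks C s_pos[of k] in auto)
  have d_step: "d (Suc k) \<le> (1 - \<kappa> k) * d k + \<theta> k * r k + \<xi> k" for k
  proof -
    have "D (Suc k) \<le> ennreal (1 - \<kappa> k) * D k + ennreal (\<theta> k) * Eq k + ennreal (\<xi> k)"
      using D_Suc[of k] by (simp add: Eq_def q_def)
    then have "ennreal (d (Suc k)) \<le> ennreal ((1 - \<kappa> k) * d k + \<theta> k * r k + \<xi> k)"
      using nonneg pars by (simp add: real ennreal_mult ennreal_plus)
    then show ?thesis
      using nonneg pars by (subst (asm) ennreal_le_iff) auto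
  qed
  define \<tau> where "\<tau> k = (t k - \<mu>) * (t k - \<mu> - 1)" for k
  have \<tau>_Suc: "\<tau> (Suc k) = s k" for k
    by (simp add: \<tau>_def t_Suc s_def)
  have \<tau>0: "0 \<le> \<tau> k" for k
    using t_ge_const[of k] mu by (simp add: \<tau>_def)
  have "summable (\<lambda>k. \<beta> / \<mu> * s k * d k)"
  proof (rule perturbed_decrease_convergent(2)[where u = "\<lambda>k. v k + \<Gamma> k * \<tau> k * d k"
        and a = "\<lambda>k. K / s k" and e = "\<lambda>k. \<Gamma> (Suc k) * s k * \<xi> k"])
    fix k
    have "\<Gamma> (Suc k) * s k * d (Suc k) \<le> \<Gamma> (Suc k) * s k * ((1 - \<kappa> k) * d k + \<theta> k * r k + \<xi> k)"
      using d_step s_pos[of k] pars(4) by (intro mult_left_mono) auto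
    also have "\<dots> = \<Gamma> (Suc k) * s k * (1 - \<kappa> k) * d k + (\<Gamma> (Suc k) * \<theta> k) * (s k * r k) + \<Gamma> (Suc k) * s k * \<xi> k"
      by (simp add: algebra_simps)
    also have "\<dots> \<le> (\<Gamma> k * \<tau> k - 5 * \<beta> / \<mu> * s k) * d k + 1 * (s k * r k) + \<Gamma> (Suc k) * s k * \<xi> k"
      using pars(3,5,6) nonneg s_pos[of k] unfolding \<tau>_def
      by (intro add_mono mult_right_mono) auto
    finally have "\<Gamma> (Suc k) * s k * d (Suc k)
        \<le> \<Gamma> k * \<tau> k * d k - 5 * \<beta> / \<mu> * s k * d k + s k * r k + \<Gamma> (Suc k) * s k * \<xi> k"
      by (simp add: left_diff_distrib)
    moreover have "0 \<le> K / s k * (\<Gamma> k * \<tau> k * d k)"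
      using K_nonneg s_pos[of k] pars(4) \<tau>0 nonneg by simp
    moreover have "5 * \<beta> / \<mu> * s k * d k = 4 * \<beta> / \<mu> * s k * d k + \<beta> / \<mu> * s k * d k"
      by (simp add: field_simps)
    moreover have "(1 + K / s k) * (v k + \<Gamma> k * \<tau> k * d k)
        = (1 + K / s k) * v k + \<Gamma> k * \<tau> k * d k + K / s k * (\<Gamma> k * \<tau> k * d k)"
      by (simp add: distrib_left distrib_right)
    ultimately show "v (Suc k) + \<Gamma> (Suc k) * \<tau> (Suc k) * d (Suc k) + \<beta> / \<mu> * s k * d k
        \<le> (1 + K / s k) * (v k + \<Gamma> k * \<tau> k * d k) + \<Gamma> (Suc k) * s k * \<xi> k"
      using step_r[of k] unfolding \<tau>_Suc by linarith
  next
    show "summable (\<lambda>k. K / s k)"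
      by (rule summable_inverse_s)
    show "summable (\<lambda>k. \<Gamma> (Suc k) * s k * \<xi> k)"
      by (rule pars(7))
    fix k
    show "0 \<le> v k + \<Gamma> k * \<tau> k * d k" "0 \<le> K / s k" "0 \<le> \<beta> / \<mu> * s k * d k"
      "0 \<le> \<Gamma> (Suc k) * s k * \<xi> k"
      using nonneg pars(3,4) \<tau>0 K_nonneg s_pos[of k] mu beta by simp_all
  qed
  from summable_mult[OF this, of "\<mu> / \<beta>"] have sum: "summable (\<lambda>k. s k * d k)"
    using mu(1) beta(1) by simp
  have "(\<integral>\<^sup>+\<omega>. (\<Sum>k. ennreal (s k) * ennreal (e k \<omega>)) \<partial>M)
      = (\<Sum>k. ennreal (s k) * (\<integral>\<^sup>+\<omega>. ennreal (e k \<omega>) \<partial>M))"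
    by (simp add: nn_integral_suminf nn_integral_cmult)
  also have "\<dots> \<le> (\<Sum>k. ennreal (s k) * D k)"
    by (intro suminf_le mult_left_mono noise(2)) auto
  also have "\<dots> = (\<Sum>k. ennreal (s k * d k))"
    using nonneg s_pos by (simp add: real ennreal_mult less_imp_le)
  also have "\<dots> = ennreal (\<Sum>k. s k * d k)"
    using sum nonneg s_pos by (intro suminf_ennreal2) (auto simp: less_imp_le)
  finally have "(\<integral>\<^sup>+\<omega>. (\<Sum>k. ennreal (s k) * ennreal (e k \<omega>)) \<partial>M) \<noteq> \<infinity>"
    by (auto simp: top_unique)
  then have "AE \<omega> in M. (\<Sum>k. ennreal (s k) * ennreal (e k \<omega>)) \<noteq> \<infinity>"
    by (intro nn_integral_PInf_AE) auto
  then show ?thesis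
  proof (rule AE_mp[OF _ AE_I2[OF impI]])
    fix \<omega> assume \<omega>: "\<omega> \<in> space M" and fin: "(\<Sum>k. ennreal (s k) * ennreal (e k \<omega>)) \<noteq> \<infinity>"
    have e0: "0 \<le> e k \<omega>" for k
      using noise(1)[OF \<omega>, of k] zero_le_power2 order_trans by blast
    have "(\<Sum>k. ennreal (s k * e k \<omega>)) \<noteq> top"
      using fin s_pos e0 by (simp add: ennreal_mult less_imp_le)
    then show "summable (\<lambda>k. s k * e k \<omega>)"
      using s_pos e0 by (intro summable_suminf_not_top) (auto simp: less_imp_le)
  qed
qed

end

section \<open>Convergence of the variance-reduced splitting method\<close>

text \<open>
  The almost sure limit is redefined as \<open>p\<close> on a null set outside of which convergence holds, so that it is
  measurable and takes values in \<open>Z\<close> everywhere.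
\<close>

lemma AE_limit_measurable:
  fixes x :: "nat \<Rightarrow> 'w \<Rightarrow> 'a::euclidean_space"
  assumes meas: "\<And>k. x k \<in> borel_measurable M"
    and AE: "AE \<omega> in M. \<exists>q\<in>Z. (\<lambda>k. x k \<omega>) \<longlonglongrightarrow> q"
    and p: "p \<in> Z"
  shows "\<exists>g \<in> borel_measurable M. (\<forall>\<omega>\<in>space M. g \<omega> \<in> Z) \<and> (AE \<omega> in M. (\<lambda>k. x k \<omega>) \<longlonglongrightarrow> g \<omega>)"
proof -
  obtain N where N: "N \<in> null_sets M" "{\<omega> \<in> space M. \<not> (\<exists>q\<in>Z. (\<lambda>k. x k \<omega>) \<longlonglongrightarrow> q)} \<subseteq> N"
    using AE by (auto elim!: AE_E simp: null_sets_def)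
  define y where "y k \<omega> = (if \<omega> \<in> N then p else x k \<omega>)" for k \<omega>
  have "\<exists>q\<in>Z. (\<lambda>k. y k \<omega>) \<longlonglongrightarrow> q" if "\<omega> \<in> space M" for \<omega>
    using that N(2) p by (cases "\<omega> \<in> N") (auto simp: y_def)
  then obtain g where g: "\<And>\<omega>. \<omega> \<in> space M \<Longrightarrow> g \<omega> \<in> Z \<and> (\<lambda>k. y k \<omega>) \<longlonglongrightarrow> g \<omega>"
    by metis
  have y: "y k \<in> borel_measurable M" for k
    unfolding y_def using N(1) meas by (intro measurable_If_set) (auto simp: null_sets_def)
  have "g \<in> borel_measurable M"
    by (rule borel_measurable_LIMSEQ_metric[where f = y]) (use y g in blast)+
  moreover have "(\<lambda>k. x k \<omega>) \<longlonglongrightarrow> g \<omega>" if "\<omega> \<in> space M" "\<omega> \<notin> N" for \<omega>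
    using g[OF that(1)] that(2) by (simp add: y_def)
  then have "AE \<omega> in M. (\<lambda>k. x k \<omega>) \<longlonglongrightarrow> g \<omega>"
    by (intro AE_I'[OF N(1)]) blast
  ultimately show ?thesis
    using g by blast
qed

theorem theorem14:
  fixes S :: "('s, 'a::euclidean_space) model"
    and F :: "'a \<Rightarrow> 'a" and T \<Phi> :: "'a \<Rightarrow> 'a set"
    and M :: "'w measure" and \<F> :: "nat \<Rightarrow> 'w measure"
    and x y z Ft :: "nat \<Rightarrow> 'w \<Rightarrow> 'a" and x0 :: 'a
    and \<Delta> :: "nat \<Rightarrow> 'w \<Rightarrow> real"
    and \<kappa> \<Theta> \<sigma> \<eta> :: "nat \<Rightarrow> real" and t \<Gamma> :: "int \<Rightarrow> real"
    and L Lhat \<rho> l \<mu> r \<nu> \<beta> \<beta>bar \<Lambda> \<Theta>low \<Gamma>low :: real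
  assumes setting: "valid_model S"
    and F_def: "F = mean_op S"
    and Phi_def: "\<Phi> = op_plus F T"
    and A1: "zer \<Phi> \<noteq> {}"
    and A2: "bounded_variance S"
    and A3: "\<rho> \<ge> 0" "maximally_co_hypomonotone \<rho> T"
    and A4: "L > 0" "average_co_coercive L S"
    and L_rho: "L * \<rho> < 1"
    and Lhat: "Lhat > L" "Lhat * \<rho> < 1"
    and betabar: "\<beta>bar = (l * (4 - Lhat * l) - 4 * \<rho>) / (4 * (1 - \<rho> * Lhat))"
    and Lambda: "\<Lambda> = (Lhat - L) / (L * Lhat)"
    and prob: "prob_space M"
    and filt: "iterate_filtration M \<F> x"
    and x0: "x0 \<in> op_dom \<Phi>"
    and Ft: "\<And>k. Ft k \<in> borel_measurable M"
    and iter: "\<And>\<omega>. \<omega> \<in> space M \<Longrightarrow>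
        vfosa_plus l T t \<eta> \<nu> x0 (\<lambda>k. Ft k \<omega>) (\<lambda>k. x k \<omega>) (\<lambda>k. y k \<omega>) (\<lambda>k. z k \<omega>)"
    and VR: "VR_property M \<F> S x Ft \<Delta> \<kappa> \<Theta> \<sigma>"
    and l: "l > 0" "2 * \<rho> \<le> l" "l < 2 * (1 + sqrt (1 - Lhat * \<rho>)) / Lhat"
    and mu: "0 < \<mu>" "\<mu> < 2 / 3"
    and r: "r \<ge> 2 + 1 / \<mu>"
    and nu: "\<nu> = \<mu> / 2"
    and beta: "0 < \<beta>" "\<beta> < (2 - \<mu>) * \<beta>bar / (2 + \<mu>)"
    and t: "\<And>k. k \<ge> -2 \<Longrightarrow> t k = \<mu> * (real_of_int k + r)"
    and eta: "\<And>k. \<eta> k = 2 * \<beta> * (t (int k) - 1) / (t (int k) - \<nu>)"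
    and low_pos: "\<Theta>low > 0" "\<Gamma>low > 0"
    and Gamma_init: "\<Gamma> (-1) > 0"
    and kappa: "\<And>k. \<kappa> k \<ge>
        1 - (\<Gamma> (int k - 1) * t (int k - 2) * (t (int k - 2) - 1))
              / (\<Gamma> (int k) * t (int k - 1) * (t (int k - 1) - 1))
          + 5 * \<beta> / (\<mu> * \<Gamma> (int k))"
    and Gamma: "\<And>k. \<Gamma> (int k) \<ge> \<Gamma>low"
    and Theta: "\<And>k. \<Theta> k \<ge> \<Theta>low"
    and Gamma_Theta: "\<And>k. \<Gamma> (int k) * \<Theta> k \<le> \<Lambda>"
    and B_inf: "summable (\<lambda>k. \<Lambda> / \<beta> *
        (t (int k - 1) * (t (int k - 1) - 1) * ((\<sigma> k)\<^sup>2 / \<Theta> k)))"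
  shows "(AE \<omega> in M.
           summable (\<lambda>k. (real k + 1) * (norm (FBS l F T (x k \<omega>)))\<^sup>2) \<and>
           summable (\<lambda>k. (real k + 1)\<^sup>2 * (norm (Ft k \<omega> - F (x k \<omega>)))\<^sup>2) \<and>
           summable (\<lambda>k. (real k + 1) * (norm (x (Suc k) \<omega> - x k \<omega>))\<^sup>2)) \<and>
         (AE \<omega> in M.
           (\<lambda>k. (real k)\<^sup>2 * (norm (FBS l F T (x k \<omega>)))\<^sup>2) \<longlonglongrightarrow> 0 \<and>
           (\<lambda>k. (real k)\<^sup>2 * (norm (x (Suc k) \<omega> - x k \<omega>))\<^sup>2) \<longlonglongrightarrow> 0) \<and>
         (\<exists>xstar \<in> borel_measurable M.
           (\<forall>\<omega>\<in>space M. xstar \<omega> \<in> zer \<Phi>) \<and>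
           (AE \<omega> in M. (\<lambda>k. x k \<omega>) \<longlonglongrightarrow> xstar \<omega> \<and> (\<lambda>k. z k \<omega>) \<longlonglongrightarrow> xstar \<omega>))"
proof -
  interpret prob_space M by (rule prob)
  have L0: "0 < L" "L < Lhat" using A4(1) Lhat(1) by auto
  note model = setting A2 L0(1) A4(2)
  have \<rho>l: "\<rho> < l" using A3(1) l by linarith
  interpret R: co_hypomonotone_resolvent T \<rho> l
    using A3(2) l(1,2) \<rho>l by unfold_locales
  define G where "G = (\<lambda>a. FBS l F T a)"
  define Q where "Q a b = (F a - F b) \<bullet> (a - b) - (1 / Lhat) * (norm (F a - F b))\<^sup>2" for a b
  have \<Lambda>: "0 < \<Lambda>" using L0 by (simp add: Lambda)
  have Q_ge: "\<Lambda> * mean_sq_diff S a b \<le> Q a b" for a b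
    unfolding Q_def Lambda F_def using mean_sq_diff_le_excess[OF model L0(2)] by simp
  have Q0: "0 \<le> Q a b" for a b
    using Q_ge[of a b] mult_nonneg_nonneg[OF less_imp_le[OF \<Lambda>] mean_sq_diff_nonneg[of S a b]] by linarith
  \<comment> \<open>since \<open>(1 + \<mu>) (2 - \<mu>) \<le> 2 + \<mu>\<close>\<close>
  have \<beta>\<mu>: "\<beta> * (1 + \<mu>) \<le> \<beta>bar"
  proof -
    have "\<beta> * (1 + \<mu>) * (2 - \<mu>) \<le> \<beta> * (2 + \<mu>)"
      using beta(1) mu(1) by (simp add: algebra_simps)
    also have "\<dots> \<le> \<beta>bar * (2 - \<mu>)"
      using beta(2) mu by (simp add: field_simps)
    finally show ?thesis using mu by simp
  qed
  interpret I: fast_krasnoselskii_mann G Q \<beta> \<beta>bar \<mu> r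
  proof
    fix a b
    show "\<beta>bar * (norm (G a - G b))\<^sup>2 + Q a b \<le> (G a - G b) \<bullet> (a - b)"
      unfolding G_def Q_def betabar using L0 Lhat(2) by (intro R.FBS_co_coercive) auto
  qed (use mu r beta(1) \<beta>\<mu> Q0 in auto)
  have t_eq: "t (int k) = I.t k" "t (int k - 1) = I.t k - \<mu>" "t (int (Suc k) - 1) = I.t k"
    "t (int (Suc k) - 2) = I.t k - \<mu>" for k
    by (simp_all add: t I.t_def algebra_simps)
  have eta_eq: "\<eta> k = I.\<eta> k" for k
    by (simp add: eta t_eq nu I.\<eta>_def)
  obtain p where p: "p \<in> zer \<Phi>" using A1 by auto
  have zer: "G q = 0 \<longleftrightarrow> q \<in> zer \<Phi>" for q
    unfolding G_def Phi_def by (rule R.FBS_eq_0_iff)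
  have Gp: "G p = 0" using p zer by simp
  define g where "g k \<omega> = fbs_residual l T (Ft k \<omega>) (x k \<omega>)" for k \<omega>
  define \<epsilon> where "\<epsilon> k \<omega> = g k \<omega> - G (x k \<omega>)" for k \<omega>
  define e where "e k \<omega> = (norm (Ft k \<omega> - F (x k \<omega>)))\<^sup>2" for k \<omega>
  have \<epsilon>_le: "(norm (\<epsilon> k \<omega>))\<^sup>2 \<le> e k \<omega>" for k \<omega>
    unfolding \<epsilon>_def e_def g_def G_def by (intro power_mono R.fbs_residual_diff_le) simp
  have init: "x 0 \<omega> = x0" "z 0 \<omega> = x0"
    and y_eq: "y k \<omega> = ((I.t k - 1) / I.t k) *\<^sub>R x k \<omega> + (1 / I.t k) *\<^sub>R z k \<omega>"
    and x_eq: "x (Suc k) \<omega> = y k \<omega> - I.\<eta> k *\<^sub>R g k \<omega>"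
    and z_eq: "z (Suc k) \<omega> = z k \<omega> - (\<mu> / 2 * I.\<eta> k) *\<^sub>R g k \<omega>" if "\<omega> \<in> space M" for k \<omega>
    using iter[OF that] by (simp_all add: vfosa_plus_def g_def t_eq eta_eq nu)
  have iterates: "I.perturbed_iterates (\<lambda>k. \<epsilon> k \<omega>) (\<lambda>k. x k \<omega>) (\<lambda>k. z k \<omega>)" if "\<omega> \<in> space M" for \<omega>
    unfolding I.perturbed_iterates_def
  proof (intro allI conjI)
    fix k
    have t0: "I.t k \<noteq> 0" using I.t_pos[of k] by simp
    have "I.t k *\<^sub>R (x (Suc k) \<omega> - x k \<omega>) = (I.t k - 1) *\<^sub>R x k \<omega> + z k \<omega>
        - (I.t k * I.\<eta> k) *\<^sub>R g k \<omega> - I.t k *\<^sub>R x k \<omega>"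
      unfolding x_eq[OF that] y_eq[OF that]
      using t0 by (simp add: scaleR_add_right scaleR_diff_right)
    also have "\<dots> = z k \<omega> - x k \<omega> - (I.t k * I.\<eta> k) *\<^sub>R (G (x k \<omega>) + \<epsilon> k \<omega>)"
      by (simp add: \<epsilon>_def algebra_simps)
    finally show "I.t k *\<^sub>R (x (Suc k) \<omega> - x k \<omega>)
        = z k \<omega> - x k \<omega> - (I.t k * I.\<eta> k) *\<^sub>R (G (x k \<omega>) + \<epsilon> k \<omega>)" .
    show "z (Suc k) \<omega> = z k \<omega> - (\<mu> / 2 * I.\<eta> k) *\<^sub>R (G (x k \<omega>) + \<epsilon> k \<omega>)"
      using z_eq[OF that] by (simp add: \<epsilon>_def)
  qed

  have subalg: "subalgebra M (\<F> k)" for k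
    using filt by (simp add: iterate_filtration_def)
  have x_meas [measurable]: "x k \<in> borel_measurable M" for k
    using filt by (intro measurable_from_subalg[OF subalg[of k]]) (simp add: iterate_filtration_def)
  have Ft_meas [measurable]: "Ft k \<in> borel_measurable M" for k
    by (rule Ft)
  have Fx_meas [measurable]: "(\<lambda>\<omega>. F (x k \<omega>)) \<in> borel_measurable M" for k
    unfolding F_def
    by (rule borel_measurable_continuous_on[OF continuous_on_mean_op[OF model]]) (rule x_meas)
  have g_meas [measurable]: "g k \<in> borel_measurable M" for k
  proof -
    have "(\<lambda>\<omega>. R.J (x k \<omega> - l *\<^sub>R Ft k \<omega>)) \<in> borel_measurable M"
      by (rule borel_measurable_continuous_on[OF R.continuous_on_J[OF continuous_on_id]]) measurable
    then show ?thesis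
      unfolding g_def R.fbs_residual_J by measurable
  qed
  have z_meas [measurable]: "z k \<in> borel_measurable M" for k
  proof (induction k)
    case 0
    show ?case
      by (subst measurable_cong[where g = "\<lambda>_. x0"]) (use init in auto)
  next
    case (Suc k)
    then have "(\<lambda>\<omega>. z k \<omega> - (\<mu> / 2 * I.\<eta> k) *\<^sub>R g k \<omega>) \<in> borel_measurable M"
      by measurable
    then show ?case
      by (subst measurable_cong[where g = "\<lambda>\<omega>. z k \<omega> - (\<mu> / 2 * I.\<eta> k) *\<^sub>R g k \<omega>"]) (use z_eq in auto)
  qed
  have e_meas [measurable]: "e k \<in> borel_measurable M" for k
    unfolding e_def by measurable
  have Q_meas [measurable]: "(\<lambda>\<omega>. Q (x (Suc k) \<omega>) (x k \<omega>)) \<in> borel_measurable M" for k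
    unfolding Q_def by measurable
  have \<Delta>_meas [measurable]: "\<Delta> k \<in> borel_measurable M" for k
    using VR by (simp add: VR_property_def)
  have \<Delta>0: "0 \<le> \<Delta> k \<omega>" if "\<omega> \<in> space M" for k \<omega>
    using VR that by (simp add: VR_property_def)
  have pars: "\<kappa> k \<le> 1" "0 \<le> \<Theta> k" for k
    using VR by (simp_all add: VR_property_def)

  define D where "D k = (\<integral>\<^sup>+\<omega>. ennreal (\<Delta> k \<omega>) \<partial>M)" for k
  define b where "b k \<omega> = (1 - \<kappa> k) * (if k = 0 then 0 else \<Delta> (k - 1) \<omega>)
      + \<Theta> k * mean_sq_diff S (x k \<omega>) (x (k - 1) \<omega>) + (\<sigma> k)\<^sup>2" for k \<omega>
  \<comment> \<open>the conditional bounds are used only after integration over the whole space\<close>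
  have total: "(\<integral>\<^sup>+\<omega>. nn_cond_exp M (\<F> k) f \<omega> \<partial>M) = (\<integral>\<^sup>+\<omega>. f \<omega> \<partial>M)"
    if "f \<in> borel_measurable M" for f k
  proof -
    interpret finite_measure_subalgebra M "\<F> k"
      using subalg by unfold_locales
    show ?thesis
      using nn_cond_exp_intg[of "\<lambda>_. 1" f] that by simp
  qed
  have e_D: "(\<integral>\<^sup>+\<omega>. ennreal (e k \<omega>) \<partial>M) \<le> D k" and D_b: "D k \<le> (\<integral>\<^sup>+\<omega>. ennreal (b k \<omega>) \<partial>M)" for k
  proof -
    have "AE \<omega> in M. nn_cond_exp M (\<F> k) (\<lambda>\<omega>. ennreal (e k \<omega>)) \<omega>
        \<le> nn_cond_exp M (\<F> k) (\<lambda>\<omega>. ennreal (\<Delta> k \<omega>)) \<omega> \<and>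
      nn_cond_exp M (\<F> k) (\<lambda>\<omega>. ennreal (\<Delta> k \<omega>)) \<omega> \<le> ennreal (b k \<omega>)"
      using VR unfolding VR_property_def e_def b_def F_def by auto
    then have "AE \<omega> in M. nn_cond_exp M (\<F> k) (\<lambda>\<omega>. ennreal (e k \<omega>)) \<omega>
        \<le> nn_cond_exp M (\<F> k) (\<lambda>\<omega>. ennreal (\<Delta> k \<omega>)) \<omega>"
      "AE \<omega> in M. nn_cond_exp M (\<F> k) (\<lambda>\<omega>. ennreal (\<Delta> k \<omega>)) \<omega> \<le> ennreal (b k \<omega>)"
      by (auto elim: AE_mp)
    from this[THEN nn_integral_mono_AE]
    show "(\<integral>\<^sup>+\<omega>. ennreal (e k \<omega>) \<partial>M) \<le> D k" "D k \<le> (\<integral>\<^sup>+\<omega>. ennreal (b k \<omega>) \<partial>M)"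
      by (simp_all add: total D_def)
  qed
  \<comment> \<open>at \<open>k = 0\<close> the convention \<open>x\<^sup>-\<^sup>1 = x\<^sup>0\<close> leaves only \<open>\<sigma> 0\<close> on the right\<close>
  have D0: "D 0 < \<infinity>"
  proof -
    have "mean_sq_diff S a a = 0" for a
      by (cases S) simp_all
    then have "(\<integral>\<^sup>+\<omega>. ennreal (b 0 \<omega>) \<partial>M) = ennreal ((\<sigma> 0)\<^sup>2)"
      by (simp add: b_def emeasure_space_1)
    with D_b[of 0] show ?thesis
      by (simp add: le_less_trans)
  qed
  have D_Suc: "D (Suc k) \<le> ennreal (1 - \<kappa> (Suc k)) * D k
      + ennreal (\<Theta> (Suc k) / \<Lambda>) * (\<integral>\<^sup>+\<omega>. ennreal (Q (x (Suc k) \<omega>) (x k \<omega>)) \<partial>M)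
      + ennreal ((\<sigma> (Suc k))\<^sup>2)" for k
  proof -
    have "D (Suc k) \<le> (\<integral>\<^sup>+\<omega>. ennreal (b (Suc k) \<omega>) \<partial>M)" by (rule D_b)
    also have "\<dots> \<le> (\<integral>\<^sup>+\<omega>. ennreal (1 - \<kappa> (Suc k)) * ennreal (\<Delta> k \<omega>)
        + ennreal (\<Theta> (Suc k) / \<Lambda>) * ennreal (Q (x (Suc k) \<omega>) (x k \<omega>)) + ennreal ((\<sigma> (Suc k))\<^sup>2) \<partial>M)"
    proof (rule nn_integral_mono)
      fix \<omega> assume \<omega>: "\<omega> \<in> space M"
      have "mean_sq_diff S (x (Suc k) \<omega>) (x k \<omega>) \<le> Q (x (Suc k) \<omega>) (x k \<omega>) / \<Lambda>"
        using Q_ge \<Lambda> by (simp add: pos_le_divide_eq mult.commute)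
      from mult_left_mono[OF this pars(2)[of "Suc k"]]
      have "b (Suc k) \<omega> \<le> (1 - \<kappa> (Suc k)) * \<Delta> k \<omega>
          + \<Theta> (Suc k) / \<Lambda> * Q (x (Suc k) \<omega>) (x k \<omega>) + (\<sigma> (Suc k))\<^sup>2"
        by (simp add: b_def)
      also have "ennreal \<dots> = ennreal (1 - \<kappa> (Suc k)) * ennreal (\<Delta> k \<omega>)
        + ennreal (\<Theta> (Suc k) / \<Lambda>) * ennreal (Q (x (Suc k) \<omega>) (x k \<omega>)) + ennreal ((\<sigma> (Suc k))\<^sup>2)"
        using pars \<Lambda> Q0 \<Delta>0[OF \<omega>]
        by (subst ennreal_mult[symmetric], simp, simp, subst ennreal_mult[symmetric], simp, simp,
            subst ennreal_plus[symmetric], simp, simp, subst ennreal_plus[symmetric]) auto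
      finally show "ennreal (b (Suc k) \<omega>) \<le> \<dots>" by (simp add: ennreal_leI)
    qed
    also have "\<dots> = ennreal (1 - \<kappa> (Suc k)) * D k
      + ennreal (\<Theta> (Suc k) / \<Lambda>) * (\<integral>\<^sup>+\<omega>. ennreal (Q (x (Suc k) \<omega>) (x k \<omega>)) \<partial>M)
      + ennreal ((\<sigma> (Suc k))\<^sup>2)"
      by (simp add: D_def nn_integral_add nn_integral_cmult emeasure_space_1)
    finally show ?thesis .
  qed

  have \<Gamma>0: "0 < \<Gamma> (int k)" for k
    using Gamma[of k] low_pos by linarith
  have \<Theta>0: "0 < \<Theta> k" for k
    using Theta[of k] low_pos by linarith
  \<comment> \<open>the condition on \<open>\<kappa>\<close> at \<open>k + 1\<close>, multiplied by \<open>\<Gamma> (k + 1) s k\<close>\<close>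
  have weights: "\<Gamma> (int (Suc k)) * I.s k * (1 - \<kappa> (Suc k))
      \<le> \<Gamma> (int k) * ((I.t k - \<mu>) * (I.t k - \<mu> - 1)) - 5 * \<beta> / \<mu> * I.s k" for k
  proof -
    define A B where "A = \<Gamma> (int k) * ((I.t k - \<mu>) * (I.t k - \<mu> - 1))" and "B = \<Gamma> (int (Suc k))"
    have B: "0 < B" "0 < I.s k" using \<Gamma>0[of "Suc k"] I.s_pos by (simp_all add: B_def)
    have "int (Suc k) - 1 = int k" by simp
    then have "1 - \<kappa> (Suc k) \<le> A / (B * I.s k) - 5 * \<beta> / (\<mu> * B)"
      using kappa[of "Suc k"] unfolding t_eq A_def B_def I.s_def by (simp add: mult.assoc I.t_Suc)
    then have "B * I.s k * (1 - \<kappa> (Suc k)) \<le> B * I.s k * (A / (B * I.s k) - 5 * \<beta> / (\<mu> * B))"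
      using B by (intro mult_left_mono) auto
    also have "\<dots> = A - 5 * \<beta> / \<mu> * I.s k"
      using B mu(1) by (simp add: right_diff_distrib)
    finally show ?thesis by (simp add: A_def B_def)
  qed
  have sum_\<sigma>: "summable (\<lambda>k. \<Gamma> (int (Suc k)) * I.s k * (\<sigma> (Suc k))\<^sup>2)"
  proof (rule summable_comparison_test'[of _ 0])
    have "summable (\<lambda>k. \<Lambda> / \<beta> * (I.s k * ((\<sigma> (Suc k))\<^sup>2 / \<Theta> (Suc k))))"
      using B_inf[THEN summable_Suc_iff[THEN iffD2]] unfolding t_eq(2) I.t_Suc I.s_def by simp
    from summable_mult[OF this, of \<beta>]
    show "summable (\<lambda>k. \<Lambda> * (I.s k * ((\<sigma> (Suc k))\<^sup>2 / \<Theta> (Suc k))))"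
      using beta(1) by simp
    fix k
    have "\<Gamma> (int (Suc k)) \<le> \<Lambda> / \<Theta> (Suc k)"
      using Gamma_Theta[of "Suc k"] \<Theta>0[of "Suc k"] by (simp add: pos_le_divide_eq)
    then have "\<Gamma> (int (Suc k)) * (I.s k * (\<sigma> (Suc k))\<^sup>2) \<le> \<Lambda> / \<Theta> (Suc k) * (I.s k * (\<sigma> (Suc k))\<^sup>2)"
      using I.s_pos[of k] by (intro mult_right_mono) auto
    then show "norm (\<Gamma> (int (Suc k)) * I.s k * (\<sigma> (Suc k))\<^sup>2)
        \<le> \<Lambda> * (I.s k * ((\<sigma> (Suc k))\<^sup>2 / \<Theta> (Suc k)))"
      using \<Gamma>0[of "Suc k"] I.s_pos[of k] by (simp add: abs_of_pos abs_mult mult.assoc)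
  qed
  have AE_noise: "AE \<omega> in M. summable (\<lambda>k. I.s k * e k \<omega>)"
  proof (rule I.AE_summable_noise[where x = x and z = z and \<epsilon> = \<epsilon> and D = D and \<kappa> = "\<lambda>k. \<kappa> (Suc k)"
        and \<theta> = "\<lambda>k. \<Theta> (Suc k) / \<Lambda>" and \<Gamma> = "\<lambda>k. \<Gamma> (int k)" and \<xi> = "\<lambda>k. (\<sigma> (Suc k))\<^sup>2",
        OF Gp prob])
    show "\<Gamma> (int (Suc k)) * (\<Theta> (Suc k) / \<Lambda>) \<le> 1" for k
      using Gamma_Theta[of "Suc k"] \<Lambda> by simp
  qed (use init iterates \<epsilon>_le e_D D0 D_Suc pars \<Lambda> \<Gamma>0 weights sum_\<sigma> in \<open>auto simp: less_imp_le\<close>)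

  have path: "(summable (\<lambda>k. (real k + 1) * (norm (FBS l F T (x k \<omega>)))\<^sup>2) \<and>
      summable (\<lambda>k. (real k + 1)\<^sup>2 * (norm (Ft k \<omega> - F (x k \<omega>)))\<^sup>2) \<and>
      summable (\<lambda>k. (real k + 1) * (norm (x (Suc k) \<omega> - x k \<omega>))\<^sup>2)) \<and>
     ((\<lambda>k. (real k)\<^sup>2 * (norm (FBS l F T (x k \<omega>)))\<^sup>2) \<longlonglongrightarrow> 0 \<and>
      (\<lambda>k. (real k)\<^sup>2 * (norm (x (Suc k) \<omega> - x k \<omega>))\<^sup>2) \<longlonglongrightarrow> 0) \<and>
     (\<exists>q\<in>zer \<Phi>. (\<lambda>k. x k \<omega>) \<longlonglongrightarrow> q \<and> (\<lambda>k. z k \<omega>) \<longlonglongrightarrow> q)"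
    if \<omega>: "\<omega> \<in> space M" and sum: "summable (\<lambda>k. I.s k * e k \<omega>)" for \<omega>
  proof -
    have "summable (\<lambda>k. I.s k * (norm (\<epsilon> k \<omega>))\<^sup>2)"
    proof (rule summable_comparison_test'[OF sum, of 0])
      show "norm (I.s k * (norm (\<epsilon> k \<omega>))\<^sup>2) \<le> I.s k * e k \<omega>" for k
        using I.s_pos[of k] \<epsilon>_le[of k \<omega>] by (simp add: mult_left_mono)
    qed
    note conv = iterates[OF \<omega>] this Gp
    have "summable (\<lambda>k. 1 / \<mu>\<^sup>2 * (I.s k * e k \<omega>))"
      using sum by (rule summable_mult)
    then have "summable (\<lambda>k. (real k + 1)\<^sup>2 * (norm (Ft k \<omega> - F (x k \<omega>)))\<^sup>2)"
    proof (rule summable_comparison_test'[of _ 0])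
      fix k
      have "\<mu>\<^sup>2 * (real k + 1)\<^sup>2 * e k \<omega> \<le> I.s k * e k \<omega>"
        by (intro mult_right_mono I.s_ge) (simp add: e_def)
      then show "norm ((real k + 1)\<^sup>2 * (norm (Ft k \<omega> - F (x k \<omega>)))\<^sup>2) \<le> 1 / \<mu>\<^sup>2 * (I.s k * e k \<omega>)"
        using mu(1) by (simp add: e_def pos_le_divide_eq mult_ac)
    qed
    moreover have "\<exists>q\<in>zer \<Phi>. (\<lambda>k. x k \<omega>) \<longlonglongrightarrow> q \<and> (\<lambda>k. z k \<omega>) \<longlonglongrightarrow> q"
      using I.iterates_converge[OF conv] zer by blast
    ultimately show ?thesis
      using I.summable_G[OF conv] I.summable_displacement[OF conv] I.G_limit[OF conv] I.displacement_limit[OF conv]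
      unfolding G_def by blast
  qed
  have AE_path: "AE \<omega> in M. \<omega> \<in> space M \<and> summable (\<lambda>k. I.s k * e k \<omega>)"
    using AE_noise AE_space by eventually_elim simp
  have "AE \<omega> in M. \<exists>q\<in>zer \<Phi>. (\<lambda>k. x k \<omega>) \<longlonglongrightarrow> q"
    using AE_path by eventually_elim (use path in blast)
  from AE_limit_measurable[OF x_meas this p]
  obtain xstar where xstar: "xstar \<in> borel_measurable M" "\<forall>\<omega>\<in>space M. xstar \<omega> \<in> zer \<Phi>"
    "AE \<omega> in M. (\<lambda>k. x k \<omega>) \<longlonglongrightarrow> xstar \<omega>"
    by blast
  have "AE \<omega> in M. (\<lambda>k. x k \<omega>) \<longlonglongrightarrow> xstar \<omega> \<and> (\<lambda>k. z k \<omega>) \<longlonglongrightarrow> xstar \<omega>"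
    using AE_path xstar(3)
  proof eventually_elim
    case (elim \<omega>)
    then show ?case
      using path[of \<omega>] LIMSEQ_unique by blast
  qed
  with xstar(1,2) show ?thesis
  proof (intro conjI bexI[of _ xstar])
    show "AE \<omega> in M.
           summable (\<lambda>k. (real k + 1) * (norm (FBS l F T (x k \<omega>)))\<^sup>2) \<and>
           summable (\<lambda>k. (real k + 1)\<^sup>2 * (norm (Ft k \<omega> - F (x k \<omega>)))\<^sup>2) \<and>
           summable (\<lambda>k. (real k + 1) * (norm (x (Suc k) \<omega> - x k \<omega>))\<^sup>2)"
      using AE_path by eventually_elim (use path in blast)
    show "AE \<omega> in M.
           (\<lambda>k. (real k)\<^sup>2 * (norm (FBS l F T (x k \<omega>)))\<^sup>2) \<longlonglongrightarrow> 0 \<and>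
           (\<lambda>k. (real k)\<^sup>2 * (norm (x (Suc k) \<omega> - x k \<omega>))\<^sup>2) \<longlonglongrightarrow> 0"
      using AE_path by eventually_elim (use path in blast)
  qed
qed

end
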